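(* Let $q\in\{0,1\}$, and assume $\gamma(\theta)=\gamma(\pi+\theta)$ for all $\theta$ if $q=0$, and $3\gamma(\theta)>\gamma(\pi+\theta)$ for all $\theta$ if $q=1$. Let $(\vec X^m,\mu^m,\kappa^m)\in\mathbb X^h\times\mathbb K^h\times\mathbb K_0^h$, $m=0,\dots,M$, be a solution of the following scheme (ES-PFEM): for each $0\le m\le M-1$, $$\left(\frac{\vec X^{m+1}-\vec X^m}{\Delta t}\cdot\vec n^m,\phi^h\right)_{\Gamma^m}^h+\left(\partial_s\mu^{m+1},\partial_s\phi^h\right)_{\Gamma^m}^h=0,\quad\forall\phi^h\in\mathbb K^h,$$ $$\left(\mu^{m+1},\vec n^m\cdot\vec\omega^h\right)_{\Gamma^m}^h-\left(\boldsymbol B_q(\theta^m)\partial_s\vec X^{m+1},\partial_s\vec\omega^h\right)_{\Gamma^m}^h-\varepsilon^2\left(\partial_s\kappa^{m+1}\vec n^m-\tfrac12(\kappa^{m+1})^2\partial_s\vec X^{m+1},\partial_s\vec\omega^h\right)_{\Gamma^m}^h$$ $$-\frac1\eta\left(\frac{x_l^{m+1}-x_l^m}{\Delta t}\omega_1^h(0)+\frac{x_r^{m+1}-x_r^m}{\Delta t}\omega_1^h(1)\right)+\sigma\left(\omega_1^h(1)-\omega_1^h(0)\right)=0,\quad\forall\vec\omega^h=(\omega_1^h,\omega_2^h)^T\in\mathbb X^h,$$ $$\left(\frac{\kappa^{m+1}-\kappa^m}{\Delta t},\varphi^h\right)_{\Gamma^m}^h-\left(\vec n^m\cdot\partial_s\left(\frac{\vec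 X^{m+1}-\vec X^m}{\Delta t}\right),\partial_s\varphi^h\right)_{\Gamma^m}^h+\left(\partial_s\vec X^{m+1}\cdot\partial_s\left(\frac{\vec X^{m+1}-\vec X^m}{\Delta t}\right)\kappa^{m+1},\varphi^h\right)_{\Gamma^m}^h=0,\quad\forall\varphi^h\in\mathbb K_0^h.$$ Define the discrete energy, for $m=0,\dots,M$, $$W_c^m=\sum_{j=1}^J|\vec h_j^m|\gamma(\theta_j^m)+\frac{\varepsilon^2}{4}\sum_{j=1}^J|\vec h_j^m|\left((\kappa^m)^2(\rho_{j-1})+(\kappa^m)^2(\rho_j)\right)-\sigma\left(x_r^m-x_l^m\right).$$ Then there exists a minimal stabilizing function $\mathscr S_0(\theta)$ (i.e. the function $\mathscr S_0:[-\pi,\pi]\to\mathbb R$ defined in the context for the given $q$ is well defined and finite) such that, whenever $\mathscr S(\theta)\ge\mathscr S_0(\theta)$ for all $\theta\in[-\pi,\pi]$, the discrete energy is dissipative: $$W_c^{m+1}\le W_c^m\le\dots\le W_c^0,\qquad 0\le m\le M-1.$$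
   Context: **Data.** $\gamma(\theta)$ is a positive $C^2$ function on $[-\pi,\pi]$, extended $2\pi$-periodically as a $C^2$ function. Constants: $0<\varepsilon\le1$, $\eta\in(0,\infty)$, $\sigma\in\mathbb R$, time step $\Delta t>0$. For $q=0,1$, $$\boldsymbol B_q(\theta)=\begin{pmatrix}\gamma(\theta)&-\gamma'(\theta)\\\gamma'(\theta)&\gamma(\theta)\end{pmatrix}\begin{pmatrix}\cos2\theta&\sin2\theta\\\sin2\theta&-\cos2\theta\end{pmatrix}^{1-q}+\mathscr S(\theta)\left[\frac12\boldsymbol I-\frac12\begin{pmatrix}\cos2\theta&\sin2\theta\\\sin2\theta&-\cos2\theta\end{pmatrix}\right],$$ where $\boldsymbol I$ is the $2\times2$ identity matrix and $\mathscr S:[-\pi,\pi]\to\mathbb R$ is a stability function. **Minimal stabilizing function.** For $q=0$, $\mathscr S_0(\theta)$ is the infimum of the values $\mathscr S(\theta)\in\mathbb R$ for which $$\left[\gamma(\theta)\boldsymbol B_0(\theta)(\cos\hat\theta,\sin\hat\theta)^T\right]\cdot(\cos\hat\theta,\sin\hat\theta)^T\ge\gamma(\hat\theta)^2\quad\forall\hat\theta\in[-\pi,\pi].$$ For $q=1$, $\mathscr S_0(\theta)=\inf\{\alpha\ge0:\ P_\alpha(\theta,\hat\theta)-Q(\theta,\hat\theta)\ge0\ \ \forall\hat\theta\in[-\pi,\pi]\}$, where $$P_\alpha(\theta,\hat\theta)=2\sqrt{\left(\gamma(\theta)+\alpha(-\sin\hat\theta\cos\theta+\cos\hat\theta\sin\theta)^2\right)\gamma(\theta)},$$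 $$Q(\theta,\hat\theta)=\gamma(\hat\theta)+\gamma(\theta)(\sin\theta\sin\hat\theta+\cos\theta\cos\hat\theta)+\gamma'(\theta)(-\sin\hat\theta\cos\theta+\cos\hat\theta\sin\theta).$$ **Discretization.** $\mathbb I=[0,1]$ is divided into $\mathbb I_j=[\rho_{j-1},\rho_j]$, $\rho_j=jh$, $h=1/J$, $j=1,\dots,J$. $\mathbb K^h$ is the space of continuous functions on $\mathbb I$ that are affine on each $\mathbb I_j$; $\mathbb K_0^h=\{u\in\mathbb K^h:u(0)=u(1)=0\}$; $\mathbb X^h=\mathbb K^h\times\mathbb K_0^h$. The polygonal curve $\Gamma^m$ is given by $\vec X^m=(x^m,y^m)^T\in\mathbb X^h$, with contact points $x_l^m=x^m(0)$, $x_r^m=x^m(1)$, and edges $\vec h_j^m=\vec X^m(\rho_j)-\vec X^m(\rho_{j-1})$, all assumed nonzero. On $\mathbb I_j$ the unit tangent is $\vec h_j^m/|\vec h_j^m|=(\cos\theta_j^m,\sin\theta_j^m)^T$, which defines $\theta^m|_{\mathbb I_j}=\theta_j^m\in[-\pi,\pi]$, and the unit normal is $\vec n^m|_{\mathbb I_j}=-(\vec h_j^m)^\perp/|\vec h_j^m|=(-\sin\theta_j^m,\cos\theta_j^m)^T$, where $\perp$ denotes clockwise rotation by $90$ degrees. In the scheme, $\partial_s$ denotes differentiation with respect to the arclength of $\Gamma^m$: $\partial_sf=|\partial_\rho\vec X^m|^{-1}\partial_\rho f$ (elementwise). The mass-lumped inner product is $$(\vec u,\vec v)_{\Gamma^m}^h=\frac12\sum_{j=1}^J|\vec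 h_j^m|\left[(\vec u\cdot\vec v)(\rho_j^-)+(\vec u\cdot\vec v)(\rho_{j-1}^+)\right],$$ with one-sided limits at the nodes (and the same for scalar functions). The initial data $(\vec X^0,\mu^0,\kappa^0)\in\mathbb X^h\times\mathbb K^h\times\mathbb K_0^h$ are given. *)

theory Defs
  imports "HOL-Analysis.Analysis"
begin

section \<open>Surface energy and surface energy matrix\<close>

definition C2_function :: "(real \<Rightarrow> real) \<Rightarrow> bool" where
  "C2_function f \<longleftrightarrow>
     (\<forall>x. f differentiable (at x)) \<and> (\<forall>x. deriv f differentiable (at x)) \<and>
     continuous_on UNIV (deriv (deriv f))"

text \<open>The periodic extension is the function itself, so it is required to be of class C2 on
  the whole line.\<close>

definition surface_energy_density :: "(real \<Rightarrow> real) \<Rightarrow> bool" where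
  "surface_energy_density \<gamma> \<longleftrightarrow>
     (\<forall>\<theta>. \<gamma> \<theta> > 0) \<and> (\<forall>\<theta>. \<gamma> (\<theta> + 2 * pi) = \<gamma> \<theta>) \<and> C2_function \<gamma>"

definition unit_vec :: "real \<Rightarrow> real^2" where
  "unit_vec \<theta> = vector [cos \<theta>, sin \<theta>]"

definition reflection_mat :: "real \<Rightarrow> real^2^2" where
  "reflection_mat \<theta> = vector [vector [cos (2 * \<theta>), sin (2 * \<theta>)],
                              vector [sin (2 * \<theta>), - cos (2 * \<theta>)]]"

definition gamma_mat :: "(real \<Rightarrow> real) \<Rightarrow> real \<Rightarrow> real^2^2" where
  "gamma_mat \<gamma> \<theta> = vector [vector [\<gamma> \<theta>, - deriv \<gamma> \<theta>],
                           vector [deriv \<gamma> \<theta>, \<gamma> \<theta>]]"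

text \<open>The argument \<open>s\<close> is the value of the stability function at \<open>\<theta>\<close>. The conditional is the matrix
  power with exponent \<open>1 - q\<close>; the power of type class \<open>power\<close> on \<^typ>\<open>real^2^2\<close> is componentwise.\<close>

definition B_mat :: "nat \<Rightarrow> (real \<Rightarrow> real) \<Rightarrow> real \<Rightarrow> real \<Rightarrow> real^2^2" where
  "B_mat q \<gamma> s \<theta> =
     gamma_mat \<gamma> \<theta> ** (if q = 0 then reflection_mat \<theta> else mat 1)
     + s *\<^sub>R ((1/2) *\<^sub>R mat 1 - (1/2) *\<^sub>R reflection_mat \<theta>)"


section \<open>Minimal stabilizing function\<close>

definition P_fun :: "(real \<Rightarrow> real) \<Rightarrow> real \<Rightarrow> real \<Rightarrow> real \<Rightarrow> real" where
  "P_fun \<gamma> \<alpha> \<theta> \<theta>' =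
     2 * sqrt ((\<gamma> \<theta> + \<alpha> * (- sin \<theta>' * cos \<theta> + cos \<theta>' * sin \<theta>)^2) * \<gamma> \<theta>)"

definition Q_fun :: "(real \<Rightarrow> real) \<Rightarrow> real \<Rightarrow> real \<Rightarrow> real" where
  "Q_fun \<gamma> \<theta> \<theta>' =
     \<gamma> \<theta>' + \<gamma> \<theta> * (sin \<theta> * sin \<theta>' + cos \<theta> * cos \<theta>')
     + deriv \<gamma> \<theta> * (- sin \<theta>' * cos \<theta> + cos \<theta>' * sin \<theta>)"

definition stabilizing_values :: "nat \<Rightarrow> (real \<Rightarrow> real) \<Rightarrow> real \<Rightarrow> real set" where
  "stabilizing_values q \<gamma> \<theta> =
     (if q = 0
      then {s. \<forall>\<theta>'\<in>{-pi..pi}.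
              (\<gamma> \<theta> *\<^sub>R (B_mat 0 \<gamma> s \<theta> *v unit_vec \<theta>')) \<bullet> unit_vec \<theta>' \<ge> (\<gamma> \<theta>')^2}
      else {\<alpha>. \<alpha> \<ge> 0 \<and> (\<forall>\<theta>'\<in>{-pi..pi}. P_fun \<gamma> \<alpha> \<theta> \<theta>' - Q_fun \<gamma> \<theta> \<theta>' \<ge> 0)})"

text \<open>The infimum is taken in the extended reals, so that it is finite exactly if the set of
  stabilizing values is nonempty and bounded below.\<close>

definition minimal_stab :: "nat \<Rightarrow> (real \<Rightarrow> real) \<Rightarrow> real \<Rightarrow> ereal" where
  "minimal_stab q \<gamma> \<theta> = (INF s\<in>stabilizing_values q \<gamma> \<theta>. ereal s)"


section \<open>Finite element spaces\<close>

definition node :: "nat \<Rightarrow> nat \<Rightarrow> real" where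
  "node J j = real j * (1 / real J)"

definition K_space :: "nat \<Rightarrow> (real \<Rightarrow> real) set" where
  "K_space J = {u. continuous_on {0..1} u \<and>
     (\<forall>j\<in>{1..J}. \<exists>a b. \<forall>\<rho>\<in>{node J (j - 1)..node J j}. u \<rho> = a + b * \<rho>)}"

definition K0_space :: "nat \<Rightarrow> (real \<Rightarrow> real) set" where
  "K0_space J = {u \<in> K_space J. u 0 = 0 \<and> u 1 = 0}"

definition X_space :: "nat \<Rightarrow> (real \<Rightarrow> real^2) set" where
  "X_space J = {X. (\<lambda>\<rho>. X \<rho> $ 1) \<in> K_space J \<and> (\<lambda>\<rho>. X \<rho> $ 2) \<in> K0_space J}"

definition edge :: "nat \<Rightarrow> (real \<Rightarrow> real^2) \<Rightarrow> nat \<Rightarrow> real^2" where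
  "edge J X j = X (node J j) - X (node J (j - 1))"

text \<open>The function on the unit interval with value \<open>c j\<close> on the \<open>j\<close>-th element. Its values at the
  nodes are immaterial, because only one-sided limits at the nodes are used below.\<close>

definition elementwise :: "nat \<Rightarrow> (nat \<Rightarrow> 'a) \<Rightarrow> real \<Rightarrow> 'a" where
  "elementwise J c \<rho> = c (nat \<lceil>real J * \<rho>\<rceil>)"

definition perp :: "real^2 \<Rightarrow> real^2" where
  "perp v = vector [v $ 2, - v $ 1]"

definition normal :: "nat \<Rightarrow> (real \<Rightarrow> real^2) \<Rightarrow> real \<Rightarrow> real^2" where
  "normal J X = elementwise J (\<lambda>j. - (perp (edge J X j) /\<^sub>R norm (edge J X j)))"

definition tangent_angles :: "nat \<Rightarrow> (real \<Rightarrow> real^2) \<Rightarrow> (nat \<Rightarrow> real) \<Rightarrow> bool" where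
  "tangent_angles J X \<theta> \<longleftrightarrow>
     (\<forall>j\<in>{1..J}. \<theta> j \<in> {-pi..pi} \<and> edge J X j /\<^sub>R norm (edge J X j) = unit_vec (\<theta> j))"

definition arc_deriv ::
    "(real \<Rightarrow> real^2) \<Rightarrow> (real \<Rightarrow> 'a::real_normed_vector) \<Rightarrow> real \<Rightarrow> 'a" where
  "arc_deriv X f \<rho> = vector_derivative f (at \<rho>) /\<^sub>R norm (vector_derivative X (at \<rho>))"

text \<open>Covers scalar as well as vector valued functions, as the inner product on the reals is
  multiplication.\<close>

definition lumped ::
    "nat \<Rightarrow> (real \<Rightarrow> real^2) \<Rightarrow> (real \<Rightarrow> 'a::real_inner) \<Rightarrow> (real \<Rightarrow> 'a) \<Rightarrow> real" where
  "lumped J X u v =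
     1/2 * (\<Sum>j=1..J. norm (edge J X j) *
       (Lim (at_left (node J j)) (\<lambda>\<rho>. u \<rho> \<bullet> v \<rho>) +
        Lim (at_right (node J (j - 1))) (\<lambda>\<rho>. u \<rho> \<bullet> v \<rho>)))"


section \<open>The scheme and its energy\<close>

text \<open>One time step from \<open>(X, \<kappa>)\<close> to \<open>(X', \<mu>', \<kappa>')\<close>; the old chemical potential does not enter.
  The angles of the polygonal curve \<open>X\<close> are \<open>\<theta>\<close>.\<close>

definition ES_PFEM_step ::
    "nat \<Rightarrow> (real \<Rightarrow> real) \<Rightarrow> (real \<Rightarrow> real) \<Rightarrow> real \<Rightarrow> real \<Rightarrow> real \<Rightarrow> real \<Rightarrow> nat \<Rightarrow> (nat \<Rightarrow> real) \<Rightarrow>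
     (real \<Rightarrow> real^2) \<Rightarrow> (real \<Rightarrow> real) \<Rightarrow>
     (real \<Rightarrow> real^2) \<Rightarrow> (real \<Rightarrow> real) \<Rightarrow> (real \<Rightarrow> real) \<Rightarrow> bool" where
  "ES_PFEM_step q \<gamma> S \<epsilon> \<eta> \<sigma> \<Delta>t J \<theta> X \<kappa> X' \<mu>' \<kappa>' \<longleftrightarrow>
    (let n = normal J X;
         B = (\<lambda>\<rho>. let \<psi> = elementwise J \<theta> \<rho> in B_mat q \<gamma> (S \<psi>) \<psi>);
         V = (\<lambda>\<rho>. (X' \<rho> - X \<rho>) /\<^sub>R \<Delta>t)
     in
      (\<forall>\<phi>\<in>K_space J.
         lumped J X (\<lambda>\<rho>. V \<rho> \<bullet> n \<rho>) \<phi> + lumped J X (arc_deriv X \<mu>') (arc_deriv X \<phi>) = 0) \<and>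
      (\<forall>\<omega>\<in>X_space J.
         lumped J X \<mu>' (\<lambda>\<rho>. n \<rho> \<bullet> \<omega> \<rho>)
         - lumped J X (\<lambda>\<rho>. B \<rho> *v arc_deriv X X' \<rho>) (arc_deriv X \<omega>)
         - \<epsilon>^2 * lumped J X
             (\<lambda>\<rho>. arc_deriv X \<kappa>' \<rho> *\<^sub>R n \<rho> - (1/2 * (\<kappa>' \<rho>)^2) *\<^sub>R arc_deriv X X' \<rho>)
             (arc_deriv X \<omega>)
         - 1 / \<eta> * ((X' 0 $ 1 - X 0 $ 1) / \<Delta>t * \<omega> 0 $ 1 + (X' 1 $ 1 - X 1 $ 1) / \<Delta>t * \<omega> 1 $ 1)
         + \<sigma> * (\<omega> 1 $ 1 - \<omega> 0 $ 1) = 0) \<and>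
      (\<forall>\<phi>\<in>K0_space J.
         lumped J X (\<lambda>\<rho>. (\<kappa>' \<rho> - \<kappa> \<rho>) / \<Delta>t) \<phi>
         - lumped J X (\<lambda>\<rho>. n \<rho> \<bullet> arc_deriv X V \<rho>) (arc_deriv X \<phi>)
         + lumped J X (\<lambda>\<rho>. (arc_deriv X X' \<rho> \<bullet> arc_deriv X V \<rho>) * \<kappa>' \<rho>) \<phi> = 0))"

definition ES_PFEM_solution ::
    "nat \<Rightarrow> (real \<Rightarrow> real) \<Rightarrow> (real \<Rightarrow> real) \<Rightarrow> real \<Rightarrow> real \<Rightarrow> real \<Rightarrow> real \<Rightarrow> nat \<Rightarrow> nat \<Rightarrow>
     (nat \<Rightarrow> real \<Rightarrow> real^2) \<Rightarrow> (nat \<Rightarrow> real \<Rightarrow> real) \<Rightarrow> (nat \<Rightarrow> real \<Rightarrow> real) \<Rightarrow>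
     (nat \<Rightarrow> nat \<Rightarrow> real) \<Rightarrow> bool" where
  "ES_PFEM_solution q \<gamma> S \<epsilon> \<eta> \<sigma> \<Delta>t J M X \<mu> \<kappa> \<theta> \<longleftrightarrow>
     (\<forall>m\<le>M. X m \<in> X_space J \<and> \<mu> m \<in> K_space J \<and> \<kappa> m \<in> K0_space J \<and>
        (\<forall>j\<in>{1..J}. edge J (X m) j \<noteq> 0) \<and> tangent_angles J (X m) (\<theta> m)) \<and>
     (\<forall>m<M. ES_PFEM_step q \<gamma> S \<epsilon> \<eta> \<sigma> \<Delta>t J (\<theta> m) (X m) (\<kappa> m)
        (X (Suc m)) (\<mu> (Suc m)) (\<kappa> (Suc m)))"

definition discrete_energy ::
    "(real \<Rightarrow> real) \<Rightarrow> real \<Rightarrow> real \<Rightarrow> nat \<Rightarrow> (nat \<Rightarrow> real) \<Rightarrow> (real \<Rightarrow> real^2) \<Rightarrow> (real \<Rightarrow> real) \<Rightarrow> real" where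
  "discrete_energy \<gamma> \<epsilon> \<sigma> J \<theta> X \<kappa> =
     (\<Sum>j=1..J. norm (edge J X j) * \<gamma> (\<theta> j))
     + \<epsilon>^2 / 4 * (\<Sum>j=1..J. norm (edge J X j) * ((\<kappa> (node J (j - 1)))^2 + (\<kappa> (node J j))^2))
     - \<sigma> * (X 1 $ 1 - X 0 $ 1)"

end

theory Submission
  imports Defs
begin

text \<open>
  In both cases the set of stabilizing values at \<open>\<theta>\<close> is closed and upward closed, so its infimum, once
  it is known to be finite, and every number above it are stabilizing. What makes the set nonempty is a
  comparison with the squared sine: with \<open>\<delta> = \<theta>' - \<theta>\<close>, the stabilizing parameter enters the defining
  inequality through its product with \<open>(sin \<delta>)^2\<close>, while the remaining terms form a function that
  either vanishes to second order (at every zero of the sine if \<open>q = 0\<close>, by the periodicity of \<open>\<gamma>\<close> with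
  period \<open>pi\<close>; at the multiples of \<open>2 * pi\<close> if \<open>q = 1\<close>) or is negative (at the odd multiples of \<open>pi\<close>
  if \<open>q = 1\<close>, by \<open>3 * \<gamma> \<theta> > \<gamma> (pi + \<theta>)\<close>). Such a function is locally, hence by compactness
  uniformly, at most a multiple of \<open>(sin \<delta>)^2\<close>.

  The stabilizing inequality is used edge by edge, in the lemma \<open>edge_energy\<close>: for an old edge \<open>h\<close> with
  angle \<open>\<theta>\<close> and a new edge \<open>h'\<close> with angle \<open>\<theta>'\<close>, the increment of the surface energy
  \<open>norm h' * \<gamma> \<theta>' - norm h * \<gamma> \<theta>\<close> is at most \<open>(B h') \<bullet> (h' - h) / norm h\<close>. For \<open>q = 0\<close> the matrix is
  symmetric and the stabilizing inequality makes it positive semidefinite, so that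
  \<open>(B h') \<bullet> (h' - h)\<close> is at least half of the difference of the two quadratic forms. For \<open>q = 1\<close> the
  product is computed outright. In both cases the arithmetic-geometric mean inequality finishes the
  estimate. The bending energy has a similar bound, \<open>bending_bound\<close>, which rests on
  \<open>norm h' - norm h \<le> h' \<bullet> (h' - h) / norm h\<close>.

  Testing the three equations of the scheme with \<open>\<mu>'\<close>, with \<open>X' - X\<close> and with \<open>\<kappa>'\<close> and eliminating the
  mixed terms shows that the right-hand sides of the edge bounds, summed over all edges, are at most the
  amount by which the substrate energy \<open>- \<sigma> * (X 1 $ 1 - X 0 $ 1)\<close> decreases; what is discarded is the
  dissipation due to surface diffusion and to the moving contact points. The inner products become
  sums over edges because the functions that occur have one-sided limits at the nodes.
\<close>

section \<open>Functions dominated by the squared sine\<close>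

text \<open>By the mean value theorem \<open>g y = (y - x) * g' z\<close> with \<open>z\<close> between \<open>x\<close> and \<open>y\<close>, and \<open>g'\<close> grows at most
linearly away from its zero \<open>x\<close>; the sine, having slope \<open>1\<close> or \<open>-1\<close> at its zeros, controls \<open>y - x\<close>.\<close>

lemma double_zero_le_sin_squared:
  fixes g g' :: "real \<Rightarrow> real"
  assumes g: "\<And>y. (g has_real_derivative g' y) (at y)" and g': "g' differentiable (at x)"
    and zero: "g x = 0" "g' x = 0" "sin x = 0"
  shows "\<exists>C. \<forall>\<^sub>F y in nhds x. g y \<le> C * (sin y)^2"
proof -
  obtain D where D: "(g' has_real_derivative D) (at x)"
    using g' by (auto simp: real_differentiable_def)
  define K where "K = \<bar>D\<bar> + 1"
  have "((\<lambda>y. \<bar>(g' y - g' x) / (y - x)\<bar>) \<longlongrightarrow> \<bar>D\<bar>) (at x)"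
    using D by (intro tendsto_rabs) (simp add: has_field_derivative_iff)
  then have "\<forall>\<^sub>F y in at x. \<bar>(g' y - g' x) / (y - x)\<bar> < K"
    by (rule order_tendstoD) (simp add: K_def)
  then have "\<forall>\<^sub>F y in at x. \<bar>g' y\<bar> \<le> K * \<bar>y - x\<bar>"
    using eventually_neq_at_within[of x x UNIV]
    by eventually_elim (use zero in \<open>auto simp: abs_divide field_simps\<close>)
  then have 1: "\<forall>\<^sub>F y in nhds x. \<bar>g' y\<bar> \<le> K * \<bar>y - x\<bar>"
    using zero by (simp add: eventually_nhds_conv_at)
  have c: "\<bar>cos x\<bar> = 1" using zero(3) by (rule sin_zero_abs_cos_one)
  have "((\<lambda>y. \<bar>(sin y - sin x) / (y - x)\<bar>) \<longlongrightarrow> \<bar>cos x\<bar>) (at x)"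
    using DERIV_sin[of x] by (intro tendsto_rabs) (simp add: has_field_derivative_iff)
  then have "\<forall>\<^sub>F y in at x. 1/2 < \<bar>(sin y - sin x) / (y - x)\<bar>"
    by (rule order_tendstoD) (simp add: c)
  then have "\<forall>\<^sub>F y in at x. \<bar>y - x\<bar> \<le> 2 * \<bar>sin y\<bar>"
    using eventually_neq_at_within[of x x UNIV]
    by eventually_elim (use zero in \<open>auto simp: abs_divide field_simps\<close>)
  then have 2: "\<forall>\<^sub>F y in nhds x. \<bar>y - x\<bar> \<le> 2 * \<bar>sin y\<bar>"
    using zero by (simp add: eventually_nhds_conv_at)
  obtain d where d: "d > 0" "\<And>y. \<bar>y - x\<bar> < d \<Longrightarrow> \<bar>g' y\<bar> \<le> K * \<bar>y - x\<bar>"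
    using 1 by (auto simp: eventually_nhds_metric dist_real_def)
  have 3: "\<forall>\<^sub>F y in nhds x. \<bar>y - x\<bar> < d"
    using d(1) by (auto simp: eventually_nhds_metric dist_real_def)
  have "\<forall>\<^sub>F y in nhds x. g y \<le> (4 * K) * (sin y)^2"
    using 2 3
  proof eventually_elim
    case (elim y)
    have "\<exists>z. \<bar>z - x\<bar> \<le> \<bar>y - x\<bar> \<and> g y = (y - x) * g' z"
    proof (cases y x rule: linorder_cases)
      case less
      with MVT2[OF less, of g g'] g obtain z where "y < z" "z < x" "g x - g y = (x - y) * g' z" by auto
      with zero show ?thesis by (intro exI[of _ z]) (auto simp: algebra_simps)
    next
      case equal
      with zero show ?thesis by (intro exI[of _ x]) auto
    next
      case greater
      with MVT2[OF greater, of g g'] g obtain z where "x < z" "z < y" "g y - g x = (y - x) * g' z" by auto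
      with zero show ?thesis by (intro exI[of _ z]) auto
    qed
    then obtain z where z: "\<bar>z - x\<bar> \<le> \<bar>y - x\<bar>" "g y = (y - x) * g' z" by blast
    have K: "K \<ge> 0" by (simp add: K_def)
    have "g y \<le> \<bar>y - x\<bar> * \<bar>g' z\<bar>" by (metis z(2) abs_ge_self abs_mult)
    also have "\<dots> \<le> \<bar>y - x\<bar> * (K * \<bar>y - x\<bar>)"
      using d(2)[of z] z(1) elim(2) K
      by (intro mult_left_mono) (auto intro: order_trans[OF _ mult_left_mono])
    also have "\<dots> = K * \<bar>y - x\<bar> ^ 2" by (simp add: power2_eq_square)
    also have "\<dots> \<le> K * (2 * \<bar>sin y\<bar>) ^ 2"
      using elim K by (intro mult_left_mono power_mono) auto
    finally show ?case by (simp add: power_mult_distrib)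
  qed
  then show ?thesis by blast
qed

text \<open>The two remaining local situations: away from the zeros of the sine a large constant dominates \<open>g\<close>, and
where \<open>g\<close> is negative the constant \<open>0\<close> does.\<close>

lemma nonzero_or_negative_le_sin_squared:
  fixes g :: "real \<Rightarrow> real"
  assumes g: "isCont g x" and "sin x \<noteq> 0 \<or> g x < 0"
  shows "\<exists>C. \<forall>\<^sub>F y in nhds x. g y \<le> C * (sin y)^2"
proof -
  have lim: "(g \<longlongrightarrow> g x) (nhds x)"
    using g by (simp add: isCont_def tendsto_at_iff_tendsto_nhds)
  from assms(2) show ?thesis
  proof
    assume "g x < 0"
    then have "\<forall>\<^sub>F y in nhds x. g y < 0" by (rule order_tendstoD(2)[OF lim])
    then have "\<forall>\<^sub>F y in nhds x. g y \<le> 0 * (sin y)^2" by eventually_elim simp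
    then show ?thesis by blast
  next
    assume s: "sin x \<noteq> 0"
    define C where "C = (\<bar>g x\<bar> + 1) / (sin x)^2"
    have "((\<lambda>y. C * (sin y)^2 - g y) \<longlongrightarrow> C * (sin x)^2 - g x) (nhds x)"
      by (intro tendsto_intros lim filterlim_ident)
    moreover have "0 < C * (sin x)^2 - g x" using s by (simp add: C_def)
    ultimately have "\<forall>\<^sub>F y in nhds x. 0 < C * (sin y)^2 - g y" by (rule order_tendstoD)
    then have "\<forall>\<^sub>F y in nhds x. g y \<le> C * (sin y)^2" by eventually_elim simp
    then show ?thesis by blast
  qed
qed

text \<open>Bisection in place of a finite subcover: the property is additive over adjacent intervals, since the
larger of two constants serves on the union.\<close>

lemma local_to_global_le_sin_squared:
  fixes g :: "real \<Rightarrow> real"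
  assumes "a \<le> b" and loc: "\<And>x. \<exists>C. \<forall>\<^sub>F y in nhds x. g y \<le> C * (sin y)^2"
  shows "\<exists>C. \<forall>y\<in>{a..b}. g y \<le> C * (sin y)^2"
  using assms(1)
proof (induction rule: Bolzano)
  case (trans a b c)
  then obtain C D where C: "\<forall>y\<in>{a..b}. g y \<le> C * (sin y)^2" and D: "\<forall>y\<in>{b..c}. g y \<le> D * (sin y)^2"
    by blast
  have "g y \<le> max C D * (sin y)^2" if "y \<in> {a..c}" for y
  proof -
    have "g y \<le> C * (sin y)^2 \<or> g y \<le> D * (sin y)^2" using that C D by force
    moreover have "C * (sin y)^2 \<le> max C D * (sin y)^2" "D * (sin y)^2 \<le> max C D * (sin y)^2"
      by (intro mult_right_mono; simp)+
    ultimately show ?thesis by linarith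
  qed
  then show ?case by blast
next
  case (local x)
  obtain C where "\<forall>\<^sub>F y in nhds x. g y \<le> C * (sin y)^2" using loc by blast
  then obtain d where d: "d > 0" "\<And>y. \<bar>y - x\<bar> < d \<Longrightarrow> g y \<le> C * (sin y)^2"
    by (auto simp: eventually_nhds_metric dist_real_def)
  show ?case by (intro exI[of _ d] conjI allI impI exI[of _ C] ballI d) auto
qed

lemma surface_energy_densityD:
  assumes "surface_energy_density \<gamma>"
  shows "(\<gamma> has_real_derivative deriv \<gamma> x) (at x)" and "deriv \<gamma> differentiable (at x)"
    and "\<gamma> x > 0" and "\<gamma> (x + 2 * pi) = \<gamma> x"
  using assms unfolding surface_energy_density_def C2_function_def
  by (auto simp: DERIV_deriv_iff_real_differentiable)

lemma deriv_shift_differentiable: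
  assumes "surface_energy_density \<gamma>"
  shows "(\<lambda>y. deriv \<gamma> (a + y)) differentiable (at x)"
proof -
  obtain D where "(deriv \<gamma> has_real_derivative D) (at (x + a))"
    using surface_energy_densityD(2)[OF assms] by (auto simp: real_differentiable_def)
  then have "((\<lambda>y. deriv \<gamma> (y + a)) has_real_derivative D) (at x)" by (simp add: DERIV_shift)
  then show ?thesis by (auto simp: real_differentiable_def add.commute)
qed

lemma deriv_periodic:
  fixes f :: "real \<Rightarrow> real"
  assumes "\<And>x. f (x + p) = f x" and "\<And>x. f differentiable (at x)"
  shows "deriv f (x + p) = deriv f x"
proof -
  have "(f has_real_derivative deriv f (x + p)) (at (x + p))"
    using assms(2) by (simp add: DERIV_deriv_iff_real_differentiable)
  then have "((\<lambda>y. f (y + p)) has_real_derivative deriv f (x + p)) (at x)"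
    by (simp add: DERIV_shift)
  then show ?thesis using assms(1) by (simp add: DERIV_imp_deriv)
qed

lemma periodic_int:
  fixes f :: "real \<Rightarrow> real"
  assumes "\<And>x. f (x + p) = f x"
  shows "f (x + of_int k * p) = f x"
proof -
  interpret periodic_fun_simple f p by standard (use assms in auto)
  show ?thesis by (rule plus_of_int)
qed

text \<open>The defining inequality for \<open>q = 0\<close> says that this function is at most \<open>\<gamma> \<theta> * s * (sin \<delta>)^2\<close>. The terms
with \<open>cos (2 * \<delta>)\<close> and \<open>sin (2 * \<delta>)\<close> have period \<open>pi\<close> and match the value and the slope of \<open>\<gamma>^2\<close> at
\<open>\<theta>\<close>; so if \<open>\<gamma>\<close> has the same period, there is a double zero at each zero of the sine.\<close>

lemma excess_le_sin_squared_0: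
  assumes \<gamma>: "surface_energy_density \<gamma>" and per: "\<forall>\<theta>. \<gamma> \<theta> = \<gamma> (pi + \<theta>)"
  shows "\<exists>C. \<forall>\<delta>\<in>{-2*pi..2*pi}.
     (\<gamma> (\<theta> + \<delta>))^2 - (\<gamma> \<theta>)^2 * cos (2 * \<delta>) - \<gamma> \<theta> * deriv \<gamma> \<theta> * sin (2 * \<delta>) \<le> C * (sin \<delta>)^2"
    (is "\<exists>C. \<forall>\<delta>\<in>_. ?g \<delta> \<le> _")
proof (rule local_to_global_le_sin_squared)
  note [derivative_intros] = DERIV_chain2[OF surface_energy_densityD(1)[OF \<gamma>]]
  let ?g' = "\<lambda>\<delta>. 2 * \<gamma> (\<theta> + \<delta>) * deriv \<gamma> (\<theta> + \<delta>) + 2 * (\<gamma> \<theta>)^2 * sin (2 * \<delta>)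
    - 2 * \<gamma> \<theta> * deriv \<gamma> \<theta> * cos (2 * \<delta>)"
  have dg: "(?g has_real_derivative ?g' \<delta>) (at \<delta>)" for \<delta>
    by (auto intro!: derivative_eq_intros simp: algebra_simps)
  fix x :: real
  show "\<exists>C. \<forall>\<^sub>F \<delta> in nhds x. ?g \<delta> \<le> C * (sin \<delta>)^2"
  proof (cases "sin x = 0")
    case False
    then show ?thesis by (intro nonzero_or_negative_le_sin_squared DERIV_isCont[OF dg]) auto
  next
    case True
    have p: "\<gamma> (y + pi) = \<gamma> y" for y using per by (metis add.commute)
    have dp: "deriv \<gamma> (y + pi) = deriv \<gamma> y" for y
      using surface_energy_densityD[OF \<gamma>] by (intro deriv_periodic p) (auto simp: real_differentiable_def)
    obtain k :: int where k: "x = of_int k * pi" using True by (auto simp: sin_zero_iff_int2)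
    have v: "\<gamma> (\<theta> + x) = \<gamma> \<theta>" "deriv \<gamma> (\<theta> + x) = deriv \<gamma> \<theta>"
      unfolding k by (rule periodic_int p dp)+
    have t: "sin (2 * x) = 0" "cos (2 * x) = 1"
      using True by (simp_all add: sin_double cos_double_sin)
    have "(\<lambda>\<delta>. \<gamma> (\<theta> + \<delta>)) differentiable (at x)"
      by (auto simp: real_differentiable_def intro!: exI derivative_eq_intros)
    moreover have "(\<lambda>\<delta>. deriv \<gamma> (\<theta> + \<delta>)) differentiable (at x)"
      by (rule deriv_shift_differentiable[OF \<gamma>])
    moreover have "(\<lambda>\<delta>::real. sin (2*\<delta>)) differentiable (at x)" "(\<lambda>\<delta>::real. cos (2*\<delta>)) differentiable (at x)"
      by (auto simp: real_differentiable_def intro!: exI derivative_eq_intros)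
    ultimately have "?g' differentiable (at x)"
      by (intro derivative_intros) auto
    then show ?thesis
      by (intro double_zero_le_sin_squared[of ?g ?g'] dg True) (simp_all add: v t power2_eq_square)
  qed
qed auto

text \<open>The function is \<open>Q_fun\<close> minus the value \<open>2 * \<gamma> \<theta>\<close> of \<open>P_fun\<close> at the zeros of the sine. At multiples of
\<open>2 * pi\<close> it has a double zero. At the odd multiples of \<open>pi\<close> its value is
\<open>\<gamma> (pi + \<theta>) - 3 * \<gamma> \<theta>\<close>, which is where the assumption comes in.\<close>

lemma excess_le_sin_squared_1:
  assumes \<gamma>: "surface_energy_density \<gamma>" and less: "\<gamma> (pi + \<theta>) < 3 * \<gamma> \<theta>"
  shows "\<exists>C. \<forall>\<delta>\<in>{-2*pi..2*pi}.
     \<gamma> (\<theta> + \<delta>) + \<gamma> \<theta> * cos \<delta> - deriv \<gamma> \<theta> * sin \<delta> - 2 * \<gamma> \<theta> \<le> C * (sin \<delta>)^2"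
    (is "\<exists>C. \<forall>\<delta>\<in>_. ?g \<delta> \<le> _")
proof (rule local_to_global_le_sin_squared)
  note [derivative_intros] = DERIV_chain2[OF surface_energy_densityD(1)[OF \<gamma>]]
  let ?g' = "\<lambda>\<delta>. deriv \<gamma> (\<theta> + \<delta>) - \<gamma> \<theta> * sin \<delta> - deriv \<gamma> \<theta> * cos \<delta>"
  have dg: "(?g has_real_derivative ?g' \<delta>) (at \<delta>)" for \<delta>
    by (auto intro!: derivative_eq_intros simp: algebra_simps)
  have p: "\<gamma> (y + of_int k * (2 * pi)) = \<gamma> y" for y k
    by (rule periodic_int surface_energy_densityD(4) \<gamma>)+
  have dp: "deriv \<gamma> (y + of_int k * (2 * pi)) = deriv \<gamma> y" for y k
    using surface_energy_densityD[OF \<gamma>]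
    by (intro periodic_int deriv_periodic) (auto simp: real_differentiable_def)
  fix x :: real
  consider "sin x \<noteq> 0" | "sin x = 0" "cos x = 1" | "sin x = 0" "cos x = -1"
    using sin_zero_abs_cos_one[of x] by linarith
  then show "\<exists>C. \<forall>\<^sub>F \<delta> in nhds x. ?g \<delta> \<le> C * (sin \<delta>)^2"
  proof cases
    case 1
    then show ?thesis by (intro nonzero_or_negative_le_sin_squared DERIV_isCont[OF dg]) auto
  next
    case 2
    obtain k :: int where k: "x = of_int k * (2 * pi)"
      using 2(2) by (auto simp: cos_one_2pi_int)
    have v: "\<gamma> (\<theta> + x) = \<gamma> \<theta>" "deriv \<gamma> (\<theta> + x) = deriv \<gamma> \<theta>"
      unfolding k by (rule p dp)+
    have "(\<lambda>\<delta>. deriv \<gamma> (\<theta> + \<delta>)) differentiable (at x)"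
      by (rule deriv_shift_differentiable[OF \<gamma>])
    moreover have "(sin :: real \<Rightarrow> real) differentiable (at x)" "(cos :: real \<Rightarrow> real) differentiable (at x)"
      by (auto simp: real_differentiable_def intro!: exI derivative_eq_intros)
    ultimately have "?g' differentiable (at x)"
      by (intro derivative_intros) auto
    then show ?thesis
      by (intro double_zero_le_sin_squared[of ?g ?g'] dg) (simp_all add: v 2)
  next
    case 3
    then have "cos (x - pi) = 1" by (simp add: cos_diff)
    then obtain k :: int where "x - pi = of_int k * (2 * pi)"
      unfolding cos_one_2pi_int by (metis mult.assoc)
    then have k: "x = pi + of_int k * (2 * pi)" by simp
    have "\<gamma> (\<theta> + x) = \<gamma> (pi + \<theta>)"
      using p[of "pi + \<theta>" k] unfolding k by (simp add: algebra_simps)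
    with less 3 show ?thesis
      by (intro nonzero_or_negative_le_sin_squared DERIV_isCont[OF dg]) auto
  qed
qed auto

section \<open>The surface energy matrix and stabilizing values\<close>

text \<open>The bilinear form of the matrix in coordinates; its symmetry in \<open>v\<close> and \<open>w\<close> is visible. The stabilizing
term is \<open>s\<close> times the orthogonal projection onto the normal with angle \<open>\<theta> + pi/2\<close>.\<close>

lemma B_mat_0_form:
  "(B_mat 0 \<gamma> s \<theta> *v v) \<bullet> w =
     (\<gamma> \<theta> * cos (2*\<theta>) - deriv \<gamma> \<theta> * sin (2*\<theta>) + s * (sin \<theta>)^2) * (v$1 * w$1)
   + (\<gamma> \<theta> * sin (2*\<theta>) + deriv \<gamma> \<theta> * cos (2*\<theta>) - s * (sin \<theta> * cos \<theta>)) * (v$1 * w$2 + v$2 * w$1)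
   + (deriv \<gamma> \<theta> * sin (2*\<theta>) - \<gamma> \<theta> * cos (2*\<theta>) + s * (cos \<theta>)^2) * (v$2 * w$2)"
proof -
  have c: "1 - cos (2*\<theta>) = 2 * (sin \<theta>)^2" "1 + cos (2*\<theta>) = 2 * (cos \<theta>)^2"
    using cos_double_sin[of \<theta>] cos_double_cos[of \<theta>] by auto
  have s2: "sin (2*\<theta>) = 2 * (sin \<theta> * cos \<theta>)" by (simp add: sin_double)
  have "(B_mat 0 \<gamma> s \<theta> *v v) \<bullet> w =
     (\<gamma> \<theta> * cos (2*\<theta>) - deriv \<gamma> \<theta> * sin (2*\<theta>) + s/2 * (1 - cos (2*\<theta>))) * (v$1 * w$1)
   + (\<gamma> \<theta> * sin (2*\<theta>) + deriv \<gamma> \<theta> * cos (2*\<theta>) - s/2 * sin (2*\<theta>)) * (v$1 * w$2 + v$2 * w$1)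
   + (deriv \<gamma> \<theta> * sin (2*\<theta>) - \<gamma> \<theta> * cos (2*\<theta>) + s/2 * (1 + cos (2*\<theta>))) * (v$2 * w$2)"
    by (simp add: B_mat_def gamma_mat_def reflection_mat_def inner_vec_def sum_2
        matrix_vector_mult_def matrix_matrix_mult_def mat_def algebra_simps)
  then show ?thesis unfolding c s2 by simp
qed

text \<open>The last summand is the contribution of the normal projection. It vanishes if \<open>w\<close> is tangential, so
the stabilizing parameter does not enter the product with the old edge.\<close>

lemma B_mat_1_form:
  "(B_mat 1 \<gamma> s \<theta> *v v) \<bullet> w =
     \<gamma> \<theta> * (v \<bullet> w) + deriv \<gamma> \<theta> * (v$1 * w$2 - v$2 * w$1)
   + s * ((v$1 * sin \<theta> - v$2 * cos \<theta>) * (w$1 * sin \<theta> - w$2 * cos \<theta>))"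
proof -
  have c: "1 - cos (2*\<theta>) = 2 * (sin \<theta>)^2" "1 + cos (2*\<theta>) = 2 * (cos \<theta>)^2"
    using cos_double_sin[of \<theta>] cos_double_cos[of \<theta>] by auto
  have s2: "sin (2*\<theta>) = 2 * (sin \<theta> * cos \<theta>)" by (simp add: sin_double)
  have "(B_mat 1 \<gamma> s \<theta> *v v) \<bullet> w =
     \<gamma> \<theta> * (v \<bullet> w) + deriv \<gamma> \<theta> * (v$1 * w$2 - v$2 * w$1)
   + s/2 * ((1 - cos (2*\<theta>)) * (v$1 * w$1) - sin (2*\<theta>) * (v$1 * w$2 + v$2 * w$1)
       + (1 + cos (2*\<theta>)) * (v$2 * w$2))"
    by (simp add: B_mat_def gamma_mat_def reflection_mat_def inner_vec_def sum_2
        matrix_vector_mult_def matrix_matrix_mult_def mat_def algebra_simps)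
  then show ?thesis unfolding c s2 by (simp add: algebra_simps power2_eq_square)
qed

lemma B_mat_0_unit_vec:
  "(B_mat 0 \<gamma> s \<theta> *v unit_vec \<theta>') \<bullet> unit_vec \<theta>' =
     \<gamma> \<theta> * cos (2 * (\<theta>' - \<theta>)) + deriv \<gamma> \<theta> * sin (2 * (\<theta>' - \<theta>)) + s * (sin (\<theta>' - \<theta>))^2"
proof -
  have 1: "cos (2 * (\<theta>' - \<theta>)) = cos (2*\<theta>') * cos (2*\<theta>) + sin (2*\<theta>') * sin (2*\<theta>)"
    by (simp add: right_diff_distrib cos_diff)
  have 2: "sin (2 * (\<theta>' - \<theta>)) = sin (2*\<theta>') * cos (2*\<theta>) - cos (2*\<theta>') * sin (2*\<theta>)"
    by (simp add: right_diff_distrib sin_diff)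
  have 3: "sin (\<theta>' - \<theta>) = sin \<theta>' * cos \<theta> - cos \<theta>' * sin \<theta>" by (rule sin_diff)
  show ?thesis unfolding B_mat_0_form 1 2 3 cos_double[of \<theta>'] sin_double[of \<theta>']
    by (simp add: unit_vec_def algebra_simps power2_eq_square)
qed

lemma polar_angle:
  fixes v :: "real^2"
  obtains \<phi> where "\<phi> \<in> {-pi..pi}" "v = norm v *\<^sub>R unit_vec \<phi>"
proof -
  define z where "z = Complex (v$1) (v$2)"
  have n: "cmod z = norm v" by (simp add: z_def cmod_def norm_vec_def L2_set_def sum_2)
  have r: "rcis (norm v) (Arg z) = z" using rcis_cmod_Arg[of z] n by simp
  have "norm v * cos (Arg z) = v$1" "norm v * sin (Arg z) = v$2"
    using arg_cong[OF r, of Re] arg_cong[OF r, of Im] by (simp_all add: z_def)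
  then have "v = norm v *\<^sub>R unit_vec (Arg z)"
    by (simp add: vec_eq_iff forall_2 unit_vec_def)
  moreover have "Arg z \<in> {-pi..pi}" using Arg_bounded[of z] by auto
  ultimately show ?thesis using that by blast
qed

lemma stabilizing_values_0:
  "stabilizing_values 0 \<gamma> \<theta> = {s. \<forall>\<theta>'\<in>{-pi..pi}. (\<gamma> \<theta>')^2 \<le>
     \<gamma> \<theta> * (\<gamma> \<theta> * cos (2 * (\<theta>' - \<theta>)) + deriv \<gamma> \<theta> * sin (2 * (\<theta>' - \<theta>)) + s * (sin (\<theta>' - \<theta>))^2)}"
  by (simp add: stabilizing_values_def B_mat_0_unit_vec)

lemma stabilizing_values_1:
  "stabilizing_values 1 \<gamma> \<theta> = {s. 0 \<le> s \<and> (\<forall>\<theta>'\<in>{-pi..pi}.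
     \<gamma> \<theta>' + \<gamma> \<theta> * cos (\<theta>' - \<theta>) - deriv \<gamma> \<theta> * sin (\<theta>' - \<theta>)
     \<le> 2 * sqrt ((\<gamma> \<theta> + s * (sin (\<theta>' - \<theta>))^2) * \<gamma> \<theta>))}"
proof -
  have "(- sin \<theta>' * cos \<theta> + cos \<theta>' * sin \<theta>) = - sin (\<theta>' - \<theta>)"
    "sin \<theta> * sin \<theta>' + cos \<theta> * cos \<theta>' = cos (\<theta>' - \<theta>)" for \<theta>'
    by (simp_all add: sin_diff cos_diff algebra_simps)
  then show ?thesis by (simp add: stabilizing_values_def P_fun_def Q_fun_def)
qed

text \<open>Writing \<open>b\<close> for the symmetric bilinear form, \<open>2 * b h' (h' - h) = b h' h' - b h h + b (h' - h) (h' - h)\<close>.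
The last term is nonnegative because the stabilizing inequality bounds \<open>b\<close> from below on unit vectors by
a positive number; the same bound for \<open>h'\<close> and the arithmetic-geometric mean inequality then turn the
difference of the quadratic forms into the energy increment.\<close>

lemma edge_energy_0:
  fixes \<theta> \<theta>' r r' :: real
  assumes \<gamma>: "surface_energy_density \<gamma>" and s: "s \<in> stabilizing_values 0 \<gamma> \<theta>"
    and "\<theta>' \<in> {-pi..pi}" and "r > 0"
  defines "h \<equiv> r *\<^sub>R unit_vec \<theta>" and "h' \<equiv> r' *\<^sub>R unit_vec \<theta>'"
  shows "r' * \<gamma> \<theta>' - r * \<gamma> \<theta> \<le> (B_mat 0 \<gamma> s \<theta> *v h') \<bullet> (h' - h) / r"
proof -
  define b where "b = (\<lambda>v w. (B_mat 0 \<gamma> s \<theta> *v v) \<bullet> w)"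
  define F where "F = (\<lambda>\<phi>. b (unit_vec \<phi>) (unit_vec \<phi>))"
  have pos: "\<gamma> x > 0" for x using surface_energy_densityD(3)[OF \<gamma>] .
  have F: "(\<gamma> \<phi>)^2 \<le> \<gamma> \<theta> * F \<phi>" if "\<phi> \<in> {-pi..pi}" for \<phi>
    using s that by (simp add: stabilizing_values_def F_def b_def)
  have scale: "b (c *\<^sub>R v) (c *\<^sub>R v) = c^2 * b v v" for c v
    by (simp add: b_def matrix_vector_mult_scaleR power2_eq_square)
  have psd: "b v v \<ge> 0" for v
  proof -
    obtain \<phi> where \<phi>: "\<phi> \<in> {-pi..pi}" "v = norm v *\<^sub>R unit_vec \<phi>" by (rule polar_angle)
    have "0 \<le> \<gamma> \<theta> * F \<phi>" using F[OF \<phi>(1)] by (rule order_trans[rotated]) simp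
    then have "0 \<le> F \<phi>" using pos[of \<theta>] by (simp add: zero_le_mult_iff)
    then show ?thesis using scale[of "norm v" "unit_vec \<phi>"] \<phi>(2) by (simp add: F_def)
  qed
  have sym: "b v w = b w v" for v w by (simp add: b_def B_mat_0_form algebra_simps)
  have hh: "b h h = r^2 * \<gamma> \<theta>"
    using B_mat_0_unit_vec[of \<gamma> s \<theta> \<theta>] by (simp add: h_def scale) (simp add: b_def)
  have h'h': "b h' h' = r'^2 * F \<theta>'" by (simp add: h'_def scale F_def)
  have "2 * b h' (h' - h) = b h' h' - b h h + b (h' - h) (h' - h)"
    using sym[of h h'] by (simp add: b_def matrix_vector_mult_diff_distrib inner_diff_left inner_diff_right)
  then have 1: "b h' h' - b h h \<le> 2 * b h' (h' - h)" using psd[of "h' - h"] by simp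
  have "\<gamma> \<theta> * (2 * r * r' * \<gamma> \<theta>') \<le> r'^2 * (\<gamma> \<theta>')^2 + r^2 * (\<gamma> \<theta>)^2"
    using sum_squares_bound[of "r' * \<gamma> \<theta>'" "r * \<gamma> \<theta>"] by (simp add: power_mult_distrib algebra_simps)
  also have "\<dots> \<le> r'^2 * (\<gamma> \<theta> * F \<theta>') + r^2 * (\<gamma> \<theta>)^2"
    using F[OF assms(3)] by (intro add_right_mono mult_left_mono) auto
  also have "\<dots> = \<gamma> \<theta> * (r'^2 * F \<theta>' + r^2 * \<gamma> \<theta>)" by (simp add: algebra_simps power2_eq_square)
  finally have "2 * r * r' * \<gamma> \<theta>' \<le> r'^2 * F \<theta>' + r^2 * \<gamma> \<theta>" using pos[of \<theta>] by simp
  with 1 hh h'h' have "2 * (r * (r' * \<gamma> \<theta>' - r * \<gamma> \<theta>)) \<le> 2 * b h' (h' - h)"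
    by (simp add: algebra_simps power2_eq_square)
  then show ?thesis using \<open>r > 0\<close> by (simp add: b_def pos_le_divide_eq mult.commute)
qed

text \<open>After multiplication with \<open>r\<close> the claim reads \<open>r' * r * Q \<le> r'^2 * F + r^2 * \<gamma> \<theta>\<close>, with \<open>Q\<close> from the
definition of stabilizing values and \<open>F\<close> the quadratic form at the new unit tangent. Stability is
\<open>Q \<le> 2 * sqrt (F * \<gamma> \<theta>)\<close>, so this is the arithmetic-geometric mean inequality.\<close>

lemma edge_energy_1:
  fixes \<theta> \<theta>' r r' :: real
  assumes \<gamma>: "surface_energy_density \<gamma>" and s: "s \<in> stabilizing_values 1 \<gamma> \<theta>"
    and "\<theta>' \<in> {-pi..pi}" and "r > 0" and r': "r' \<ge> 0"
  defines "h \<equiv> r *\<^sub>R unit_vec \<theta>" and "h' \<equiv> r' *\<^sub>R unit_vec \<theta>'"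
  shows "r' * \<gamma> \<theta>' - r * \<gamma> \<theta> \<le> (B_mat 1 \<gamma> s \<theta> *v h') \<bullet> (h' - h) / r"
proof -
  have pos: "\<gamma> \<theta> > 0" using surface_energy_densityD(3)[OF \<gamma>] .
  define F where "F = \<gamma> \<theta> + s * (sin (\<theta>' - \<theta>))^2"
  define G where "G = \<gamma> \<theta> * cos (\<theta>' - \<theta>) - deriv \<gamma> \<theta> * sin (\<theta>' - \<theta>)"
  have s0: "s \<ge> 0" and Q: "\<gamma> \<theta>' + G \<le> 2 * sqrt (F * \<gamma> \<theta>)"
    using s assms(3) unfolding stabilizing_values_1 F_def G_def by (auto simp: add_diff_eq)
  have F0: "F \<ge> 0" using pos s0 by (simp add: F_def)
  have h: "(B_mat 1 \<gamma> s \<theta> *v h') \<bullet> h = r' * r * G"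
    unfolding B_mat_1_form
    by (simp add: h_def h'_def G_def unit_vec_def sin_diff cos_diff inner_vec_def sum_2 algebra_simps)
  have one: "unit_vec \<theta>' \<bullet> unit_vec \<theta>' = 1" by (simp add: unit_vec_def inner_vec_def sum_2)
  have "(B_mat 1 \<gamma> s \<theta> *v unit_vec \<theta>') \<bullet> unit_vec \<theta>' = F"
    unfolding B_mat_1_form one F_def
    by (simp add: unit_vec_def sin_diff algebra_simps power2_eq_square)
  then have h': "(B_mat 1 \<gamma> s \<theta> *v h') \<bullet> h' = r'^2 * F"
    by (simp add: h'_def matrix_vector_mult_scaleR power2_eq_square)
  have "r' * r * (\<gamma> \<theta>' + G) \<le> r' * r * (2 * sqrt (F * \<gamma> \<theta>))"
    using Q r' \<open>r > 0\<close> by (intro mult_left_mono) auto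
  also have "\<dots> = 2 * (r' * sqrt F) * (r * sqrt (\<gamma> \<theta>))" by (simp add: real_sqrt_mult)
  also have "\<dots> \<le> (r' * sqrt F)^2 + (r * sqrt (\<gamma> \<theta>))^2" by (rule sum_squares_bound)
  also have "\<dots> = r'^2 * F + r^2 * \<gamma> \<theta>" using F0 pos by (simp add: power_mult_distrib)
  finally show ?thesis using \<open>r > 0\<close>
    unfolding pos_le_divide_eq[OF \<open>r > 0\<close>] inner_diff_right h h'
    by (simp add: algebra_simps power2_eq_square)
qed

lemma edge_energy:
  assumes \<gamma>: "surface_energy_density \<gamma>" and "q \<in> {0, 1}" and "s \<in> stabilizing_values q \<gamma> \<theta>"
    and "\<theta>' \<in> {-pi..pi}" and "h \<noteq> 0" and "h' \<noteq> 0"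
    and h: "h /\<^sub>R norm h = unit_vec \<theta>" and h': "h' /\<^sub>R norm h' = unit_vec \<theta>'"
  shows "norm h' * \<gamma> \<theta>' - norm h * \<gamma> \<theta> \<le> (B_mat q \<gamma> s \<theta> *v h') \<bullet> (h' - h) / norm h"
proof -
  have "h = norm h *\<^sub>R unit_vec \<theta>" "h' = norm h' *\<^sub>R unit_vec \<theta>'"
    using h[symmetric] h'[symmetric] assms(5,6) by simp_all
  moreover have "norm h > 0" using assms(5) by simp
  ultimately show ?thesis
    using edge_energy_0[OF \<gamma> _ assms(4), of s \<theta> "norm h" "norm h'"]
      edge_energy_1[OF \<gamma> _ assms(4), of s \<theta> "norm h" "norm h'"] assms(2,3) by auto
qed

lemma stabilizing_values_nonempty:
  assumes \<gamma>: "surface_energy_density \<gamma>" and "q \<in> {0, 1}"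
    and 0: "q = 0 \<Longrightarrow> \<forall>\<theta>. \<gamma> \<theta> = \<gamma> (pi + \<theta>)"
    and 1: "q = 1 \<Longrightarrow> \<forall>\<theta>. 3 * \<gamma> \<theta> > \<gamma> (pi + \<theta>)"
    and \<theta>: "\<theta> \<in> {-pi..pi}"
  shows "stabilizing_values q \<gamma> \<theta> \<noteq> {}"
proof -
  have pos: "\<gamma> \<theta> > 0" using surface_energy_densityD(3)[OF \<gamma>] .
  have rng: "\<theta>' - \<theta> \<in> {-2*pi..2*pi}" if "\<theta>' \<in> {-pi..pi}" for \<theta>' using that \<theta> by auto
  show ?thesis
  proof (cases "q = 0")
    case True
    obtain C where C: "\<And>\<delta>. \<delta> \<in> {-2*pi..2*pi} \<Longrightarrow> (\<gamma> (\<theta> + \<delta>))^2 - (\<gamma> \<theta>)^2 * cos (2 * \<delta>)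
        - \<gamma> \<theta> * deriv \<gamma> \<theta> * sin (2 * \<delta>) \<le> C * (sin \<delta>)^2"
      using excess_le_sin_squared_0[OF \<gamma> 0[OF True], of \<theta>] by blast
    have "C / \<gamma> \<theta> \<in> stabilizing_values q \<gamma> \<theta>"
      unfolding True stabilizing_values_0
    proof (rule CollectI, rule ballI)
      fix \<theta>' :: real assume "\<theta>' \<in> {-pi..pi}"
      from C[OF rng[OF this]] pos
      show "(\<gamma> \<theta>')^2 \<le> \<gamma> \<theta> * (\<gamma> \<theta> * cos (2 * (\<theta>' - \<theta>)) + deriv \<gamma> \<theta> * sin (2 * (\<theta>' - \<theta>))
          + C / \<gamma> \<theta> * (sin (\<theta>' - \<theta>))^2)"
        by (simp add: algebra_simps power2_eq_square)
    qed
    then show ?thesis by blast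
  next
    case False
    with \<open>q \<in> {0, 1}\<close> have q: "q = 1" by simp
    obtain C0 where C0: "\<And>\<delta>. \<delta> \<in> {-2*pi..2*pi} \<Longrightarrow> \<gamma> (\<theta> + \<delta>) + \<gamma> \<theta> * cos \<delta>
        - deriv \<gamma> \<theta> * sin \<delta> - 2 * \<gamma> \<theta> \<le> C0 * (sin \<delta>)^2"
      using excess_le_sin_squared_1[OF \<gamma>, of \<theta>] 1[OF q] by blast
    define C where "C = max C0 0"
    \<comment> \<open>Chosen such that \<open>(\<gamma> \<theta> + C * t / 2)^2 \<le> (\<gamma> \<theta> + \<alpha> * t) * \<gamma> \<theta>\<close> for all \<open>t\<close> between \<open>0\<close> and \<open>1\<close>.\<close>
    define \<alpha> where "\<alpha> = C + C^2 / (4 * \<gamma> \<theta>)"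
    have "\<alpha> \<in> stabilizing_values q \<gamma> \<theta>"
      unfolding q stabilizing_values_1
    proof (intro CollectI conjI ballI)
      show "0 \<le> \<alpha>" using pos by (simp add: \<alpha>_def C_def)
      fix \<theta>' :: real assume "\<theta>' \<in> {-pi..pi}"
      define t where "t = (sin (\<theta>' - \<theta>))^2"
      have t: "0 \<le> t" "t \<le> 1" by (simp_all add: t_def abs_square_le_1)
      have "C0 * t \<le> C * t" using t by (intro mult_right_mono) (auto simp: C_def)
      then have Q: "\<gamma> \<theta>' + \<gamma> \<theta> * cos (\<theta>' - \<theta>) - deriv \<gamma> \<theta> * sin (\<theta>' - \<theta>) \<le> 2 * (\<gamma> \<theta> + C * t / 2)"
        using C0[OF rng[OF \<open>\<theta>' \<in> {-pi..pi}\<close>]] by (simp add: t_def)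
      have "C^2 * t^2 \<le> C^2 * t"
        using t by (intro mult_left_mono) (auto simp: power2_eq_square mult_left_le)
      have \<alpha>: "\<alpha> * \<gamma> \<theta> = C * \<gamma> \<theta> + C^2 / 4"
        using pos by (simp add: \<alpha>_def field_simps)
      have "(\<gamma> \<theta> + C * t / 2)^2 = (\<gamma> \<theta>)^2 + C * \<gamma> \<theta> * t + C^2 * t^2 / 4"
        by (simp add: power2_eq_square field_simps)
      also have "\<dots> \<le> (\<gamma> \<theta>)^2 + C * \<gamma> \<theta> * t + C^2 * t / 4"
        using \<open>C^2 * t^2 \<le> C^2 * t\<close> by simp
      also have "\<dots> = (\<gamma> \<theta>)^2 + (\<alpha> * \<gamma> \<theta>) * t"
        unfolding \<alpha> by (simp add: distrib_right)
      also have "\<dots> = (\<gamma> \<theta> + \<alpha> * t) * \<gamma> \<theta>"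
        by (simp add: distrib_right power2_eq_square)
      finally have "(\<gamma> \<theta> + C * t / 2)^2 \<le> (\<gamma> \<theta> + \<alpha> * t) * \<gamma> \<theta>" .
      then have "\<gamma> \<theta> + C * t / 2 \<le> sqrt ((\<gamma> \<theta> + \<alpha> * t) * \<gamma> \<theta>)" by (rule real_le_rsqrt)
      with Q show "\<gamma> \<theta>' + \<gamma> \<theta> * cos (\<theta>' - \<theta>) - deriv \<gamma> \<theta> * sin (\<theta>' - \<theta>)
          \<le> 2 * sqrt ((\<gamma> \<theta> + \<alpha> * (sin (\<theta>' - \<theta>))^2) * \<gamma> \<theta>)" by (simp add: t_def)
    qed
    then show ?thesis by blast
  qed
qed

text \<open>For \<open>q = 0\<close>, testing with an angle perpendicular to \<open>\<theta>\<close> shows that every stabilizing value is at least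
\<open>\<gamma> \<theta>\<close>. For \<open>q = 1\<close> nonnegativity is part of the definition.\<close>

lemma stabilizing_values_bdd_below:
  assumes \<gamma>: "surface_energy_density \<gamma>" and "q \<in> {0, 1}" and \<theta>: "\<theta> \<in> {-pi..pi}"
  shows "bdd_below (stabilizing_values q \<gamma> \<theta>)"
proof (cases "q = 0")
  case True
  \<comment> \<open>Of the two perpendicular angles at least one lies in the interval in which the condition is imposed.\<close>
  define \<theta>' where "\<theta>' = (if \<theta> \<le> 0 then \<theta> + pi/2 else \<theta> - pi/2)"
  have \<theta>': "\<theta>' \<in> {-pi..pi}" using \<theta> by (auto simp: \<theta>'_def)
  have pos: "\<gamma> \<theta> > 0" using surface_energy_densityD(3)[OF \<gamma>] .
  have sc: "(sin (\<theta>' - \<theta>))^2 = 1" "sin (2 * (\<theta>' - \<theta>)) = 0" "cos (2 * (\<theta>' - \<theta>)) = -1"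
    by (auto simp: \<theta>'_def)
  have "\<gamma> \<theta> \<le> s" if "s \<in> stabilizing_values q \<gamma> \<theta>" for s
  proof -
    have "(\<gamma> \<theta>')^2 \<le> \<gamma> \<theta> * (\<gamma> \<theta> * cos (2 * (\<theta>' - \<theta>))
        + deriv \<gamma> \<theta> * sin (2 * (\<theta>' - \<theta>)) + s * (sin (\<theta>' - \<theta>))^2)"
      using that \<theta>' unfolding True stabilizing_values_0 by blast
    then have "(\<gamma> \<theta>')^2 \<le> \<gamma> \<theta> * (s - \<gamma> \<theta>)" unfolding sc by simp
    then have "0 \<le> \<gamma> \<theta> * (s - \<gamma> \<theta>)" by (rule order_trans[rotated]) simp
    then show ?thesis using pos by (simp add: zero_le_mult_iff)
  qed
  then show ?thesis by (auto simp: bdd_below_def)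
next
  case False
  then show ?thesis by (auto simp: bdd_below_def stabilizing_values_def)
qed

lemma stabilizing_values_closed:
  assumes "q \<in> {0, 1}"
  shows "closed (stabilizing_values q \<gamma> \<theta>)"
proof -
  have "closed {s. \<forall>x\<in>{-pi..pi}. f x \<le> g s x}"
    if "\<And>x. continuous_on UNIV (\<lambda>s. g s x)" for f :: "real \<Rightarrow> real" and g :: "real \<Rightarrow> real \<Rightarrow> real"
    unfolding Collect_ball_eq by (intro closed_INT ballI closed_Collect_le that continuous_on_const)
  moreover have "closed {s::real. 0 \<le> s}" by (intro closed_Collect_le continuous_intros)
  ultimately show ?thesis
    using assms unfolding insert_iff empty_iff
    by (elim disjE FalseE)
      (simp_all only: stabilizing_values_0 stabilizing_values_1 Collect_conj_eq closed_Int continuous_intros)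
qed

lemma stabilizing_values_upward:
  assumes "surface_energy_density \<gamma>" "q \<in> {0, 1}" "s \<in> stabilizing_values q \<gamma> \<theta>" "s \<le> s'"
  shows "s' \<in> stabilizing_values q \<gamma> \<theta>"
proof -
  have pos: "\<gamma> \<theta> > 0" using surface_energy_densityD(3)[OF assms(1)] .
  have m: "s * (sin x)^2 \<le> s' * (sin x)^2" for x using assms(4) by (intro mult_right_mono) auto
  show ?thesis
  proof (cases "q = 0")
    case True
    have "\<gamma> \<theta> * (c + s * (sin x)^2) \<le> \<gamma> \<theta> * (c + s' * (sin x)^2)" for c x
      using m pos by (intro mult_left_mono) auto
    then show ?thesis using assms(3) unfolding True stabilizing_values_0 by (auto intro: order_trans)
  next
    case False
    with assms(2) have q: "q = 1" by simp
    have "2 * sqrt ((\<gamma> \<theta> + s * (sin x)^2) * \<gamma> \<theta>) \<le> 2 * sqrt ((\<gamma> \<theta> + s' * (sin x)^2) * \<gamma> \<theta>)" for x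
      using m pos by (auto intro!: mult_right_mono)
    then show ?thesis using assms(3,4) unfolding q stabilizing_values_1 by (auto intro: order_trans)
  qed
qed

text \<open>Closedness makes the infimum itself stabilizing, and upward closedness every number above it.\<close>

lemma minimal_stab_eq_Inf:
  assumes "surface_energy_density \<gamma>" and "q \<in> {0, 1}"
    and "q = 0 \<Longrightarrow> \<forall>\<theta>. \<gamma> \<theta> = \<gamma> (pi + \<theta>)"
    and "q = 1 \<Longrightarrow> \<forall>\<theta>. 3 * \<gamma> \<theta> > \<gamma> (pi + \<theta>)"
    and "\<theta> \<in> {-pi..pi}"
  shows "minimal_stab q \<gamma> \<theta> = ereal (Inf (stabilizing_values q \<gamma> \<theta>))"
    and "s \<ge> Inf (stabilizing_values q \<gamma> \<theta>) \<Longrightarrow> s \<in> stabilizing_values q \<gamma> \<theta>"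
proof -
  let ?A = "stabilizing_values q \<gamma> \<theta>"
  have ne: "?A \<noteq> {}" using stabilizing_values_nonempty[OF assms] .
  have bb: "bdd_below ?A" using stabilizing_values_bdd_below[OF assms(1,2,5)] .
  show "minimal_stab q \<gamma> \<theta> = ereal (Inf ?A)"
    using ereal_Inf'[OF bb ne] by (simp add: minimal_stab_def)
  show "s \<ge> Inf ?A \<Longrightarrow> s \<in> ?A"
    using closed_contains_Inf[OF ne bb stabilizing_values_closed] stabilizing_values_upward assms(1,2) by blast
qed

section \<open>Mass lumping as a sum over edges\<close>

definition element :: "nat \<Rightarrow> nat \<Rightarrow> real set" where
  "element J j = {node J (j - 1)<..<node J j}"

text \<open>The one-sided limits at the left and right end of each element, which are all that the lumped inner
product sees of a function.\<close>

definition has_traces ::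
    "nat \<Rightarrow> (real \<Rightarrow> 'a::topological_space) \<Rightarrow> (nat \<Rightarrow> 'a) \<Rightarrow> (nat \<Rightarrow> 'a) \<Rightarrow> bool" where
  "has_traces J u a b \<longleftrightarrow> (\<forall>j\<in>{1..J}.
     (u \<longlongrightarrow> a j) (at_right (node J (j - 1))) \<and> (u \<longlongrightarrow> b j) (at_left (node J j)))"

definition affine_on_elements :: "nat \<Rightarrow> (real \<Rightarrow> 'a::real_normed_vector) \<Rightarrow> bool" where
  "affine_on_elements J u \<longleftrightarrow>
     (\<forall>j\<in>{1..J}. \<exists>a b. \<forall>\<rho>\<in>{node J (j - 1)..node J j}. u \<rho> = a + \<rho> *\<^sub>R b)"

definition increment :: "nat \<Rightarrow> (real \<Rightarrow> 'a::real_normed_vector) \<Rightarrow> nat \<Rightarrow> 'a" where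
  "increment J u j = u (node J j) - u (node J (j - 1))"

lemma node_diff: "j \<in> {1..J} \<Longrightarrow> node J j - node J (j - 1) = 1 / real J"
  by (auto simp: node_def of_nat_diff field_simps)

lemma node_less: "j \<in> {1..J} \<Longrightarrow> node J (j - 1) < node J j"
proof -
  assume j: "j \<in> {1..J}"
  then have "0 < 1 / real J" by simp
  with node_diff[OF j] show ?thesis by linarith
qed

lemma lumped_traces:
  assumes "has_traces J u a b" "has_traces J v c d"
  shows "lumped J X u v = (\<Sum>j=1..J. norm (edge J X j) / 2 * (b j \<bullet> d j + a j \<bullet> c j))"
proof -
  have "Lim (at_left (node J j)) (\<lambda>\<rho>. u \<rho> \<bullet> v \<rho>) = b j \<bullet> d j"
    "Lim (at_right (node J (j - 1))) (\<lambda>\<rho>. u \<rho> \<bullet> v \<rho>) = a j \<bullet> c j" if "j \<in> {1..J}" for j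
    using assms that unfolding has_traces_def by (auto intro!: tendsto_Lim tendsto_inner)
  then show ?thesis by (simp add: lumped_def sum_distrib_left)
qed

text \<open>The traces of a pointwise combination are the combined traces, as soon as limits pass through the
operation.\<close>

lemma has_traces_map2:
  assumes "has_traces J u a b" "has_traces J v c d"
    and "\<And>F x y. (u \<longlongrightarrow> x) F \<Longrightarrow> (v \<longlongrightarrow> y) F \<Longrightarrow> ((\<lambda>\<rho>. g (u \<rho>) (v \<rho>)) \<longlongrightarrow> g x y) F"
  shows "has_traces J (\<lambda>\<rho>. g (u \<rho>) (v \<rho>)) (\<lambda>j. g (a j) (c j)) (\<lambda>j. g (b j) (d j))"
  unfolding has_traces_def
  by (intro ballI conjI assms(3)) (use assms(1,2) in \<open>simp_all add: has_traces_def\<close>)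

lemma has_traces_map:
  assumes "has_traces J u a b"
    and "\<And>F x. (u \<longlongrightarrow> x) F \<Longrightarrow> ((\<lambda>\<rho>. g (u \<rho>)) \<longlongrightarrow> g x) F"
  shows "has_traces J (\<lambda>\<rho>. g (u \<rho>)) (\<lambda>j. g (a j)) (\<lambda>j. g (b j))"
  unfolding has_traces_def
  by (intro ballI conjI assms(2)) (use assms(1) in \<open>simp_all add: has_traces_def\<close>)

lemma has_traces_diff:
  fixes u v :: "real \<Rightarrow> 'a::real_normed_vector"
  assumes "has_traces J u a b" "has_traces J v c d"
  shows "has_traces J (\<lambda>\<rho>. u \<rho> - v \<rho>) (\<lambda>j. a j - c j) (\<lambda>j. b j - d j)"
  by (rule has_traces_map2[OF assms, where g = "(-)"]) (erule (1) tendsto_diff)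

lemma has_traces_scaleR:
  fixes v :: "real \<Rightarrow> 'a::real_normed_vector"
  assumes "has_traces J u a b" "has_traces J v c d"
  shows "has_traces J (\<lambda>\<rho>. u \<rho> *\<^sub>R v \<rho>) (\<lambda>j. a j *\<^sub>R c j) (\<lambda>j. b j *\<^sub>R d j)"
  by (rule has_traces_map2[OF assms, where g = "(*\<^sub>R)"]) (erule (1) tendsto_scaleR)

lemma has_traces_inner:
  fixes u v :: "real \<Rightarrow> 'a::real_inner"
  assumes "has_traces J u a b" "has_traces J v c d"
  shows "has_traces J (\<lambda>\<rho>. u \<rho> \<bullet> v \<rho>) (\<lambda>j. a j \<bullet> c j) (\<lambda>j. b j \<bullet> d j)"
  by (rule has_traces_map2[OF assms, where g = "(\<bullet>)"]) (erule (1) tendsto_inner)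

lemma has_traces_mult:
  fixes u v :: "real \<Rightarrow> real"
  assumes "has_traces J u a b" "has_traces J v c d"
  shows "has_traces J (\<lambda>\<rho>. u \<rho> * v \<rho>) (\<lambda>j. a j * c j) (\<lambda>j. b j * d j)"
  by (rule has_traces_map2[OF assms, where g = "(*)"]) (erule (1) tendsto_mult)

lemma has_traces_cmult:
  fixes u :: "real \<Rightarrow> real"
  assumes "has_traces J u a b"
  shows "has_traces J (\<lambda>\<rho>. t * u \<rho>) (\<lambda>j. t * a j) (\<lambda>j. t * b j)"
  by (rule has_traces_map[OF assms, where g = "\<lambda>x. t * x"]) (erule tendsto_mult_left)

lemma has_traces_divide:
  fixes u :: "real \<Rightarrow> real"
  assumes "has_traces J u a b"
  shows "has_traces J (\<lambda>\<rho>. u \<rho> / t) (\<lambda>j. a j / t) (\<lambda>j. b j / t)"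
  by (rule has_traces_map[OF assms, where g = "\<lambda>x. x / t"]) (simp add: divide_inverse tendsto_mult_right)

lemma has_traces_power2:
  fixes u :: "real \<Rightarrow> real"
  assumes "has_traces J u a b"
  shows "has_traces J (\<lambda>\<rho>. (u \<rho>)^2) (\<lambda>j. (a j)^2) (\<lambda>j. (b j)^2)"
  by (rule has_traces_map[OF assms, where g = "\<lambda>x. x^2"]) (erule tendsto_power)

text \<open>This serves \<open>elementwise\<close> functions and arclength derivatives of affine ones, whose values at the
nodes depend only on conventions.\<close>

lemma has_traces_const:
  assumes "\<And>j \<rho>. j \<in> {1..J} \<Longrightarrow> \<rho> \<in> element J j \<Longrightarrow> u \<rho> = c j"
  shows "has_traces J u c c"
  unfolding has_traces_def
proof (intro ballI conjI)
  fix j assume j: "j \<in> {1..J}"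
  show "(u \<longlongrightarrow> c j) (at_right (node J (j - 1)))"
    by (rule tendsto_eventually, rule eventually_at_rightI[OF _ node_less[OF j]])
      (use assms[OF j] in \<open>simp add: element_def\<close>)
  show "(u \<longlongrightarrow> c j) (at_left (node J j))"
    by (rule tendsto_eventually, rule eventually_at_leftI[OF _ node_less[OF j]])
      (use assms[OF j] in \<open>simp add: element_def\<close>)
qed

lemma has_traces_affine:
  assumes "affine_on_elements J u"
  shows "has_traces J u (\<lambda>j. u (node J (j - 1))) (\<lambda>j. u (node J j))"
  unfolding has_traces_def
proof (intro ballI conjI)
  fix j assume j: "j \<in> {1..J}"
  obtain a b where ab: "\<And>\<rho>. \<rho> \<in> {node J (j - 1)..node J j} \<Longrightarrow> u \<rho> = a + \<rho> *\<^sub>R b"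
    using assms j unfolding affine_on_elements_def by blast
  note less = node_less[OF j]
  have "((\<lambda>\<rho>. a + \<rho> *\<^sub>R b) \<longlongrightarrow> u (node J (j - 1))) (at_right (node J (j - 1)))"
    using less by (subst ab) (simp, intro tendsto_intros)
  moreover have "\<forall>\<^sub>F \<rho> in at_right (node J (j - 1)). u \<rho> = a + \<rho> *\<^sub>R b"
    by (rule eventually_at_rightI[OF _ less]) (simp add: ab)
  ultimately show "(u \<longlongrightarrow> u (node J (j - 1))) (at_right (node J (j - 1)))"
    by (simp cong: tendsto_cong)
  have "((\<lambda>\<rho>. a + \<rho> *\<^sub>R b) \<longlongrightarrow> u (node J j)) (at_left (node J j))"
    using less by (subst ab) (simp, intro tendsto_intros)
  moreover have "\<forall>\<^sub>F \<rho> in at_left (node J j). u \<rho> = a + \<rho> *\<^sub>R b"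
    by (rule eventually_at_leftI[OF _ less]) (simp add: ab)
  ultimately show "(u \<longlongrightarrow> u (node J j)) (at_left (node J j))"
    by (simp cong: tendsto_cong)
qed

lemma vector_derivative_affine:
  assumes "affine_on_elements J u" and j: "j \<in> {1..J}" and \<rho>: "\<rho> \<in> element J j"
  shows "vector_derivative u (at \<rho>) = real J *\<^sub>R increment J u j"
proof -
  obtain a b where ab: "\<And>\<rho>. \<rho> \<in> {node J (j - 1)..node J j} \<Longrightarrow> u \<rho> = a + \<rho> *\<^sub>R b"
    using assms unfolding affine_on_elements_def by blast
  have "increment J u j = (node J j - node J (j - 1)) *\<^sub>R b"
    using node_less[OF j] by (simp add: increment_def ab scaleR_diff_left)
  then have b: "b = real J *\<^sub>R increment J u j"
    using j unfolding node_diff[OF j] by simp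
  have "((\<lambda>\<rho>. a + \<rho> *\<^sub>R b) has_vector_derivative b) (at \<rho>)"
    by (auto intro!: derivative_eq_intros)
  then have "(u has_vector_derivative b) (at \<rho>)"
    by (rule has_vector_derivative_transform_within_open[where S = "element J j"])
      (use \<rho> in \<open>auto simp: element_def ab\<close>)
  then show ?thesis unfolding b by (rule vector_derivative_at)
qed

lemma arc_deriv_affine:
  assumes "affine_on_elements J X" "affine_on_elements J u" "j \<in> {1..J}" "\<rho> \<in> element J j"
  shows "arc_deriv X u \<rho> = increment J u j /\<^sub>R norm (edge J X j)"
proof -
  have "edge J X j = increment J X j" by (simp add: edge_def increment_def)
  moreover have "J \<noteq> 0" using assms(3) by auto
  ultimately show ?thesis
    unfolding arc_deriv_def vector_derivative_affine[OF assms(1,3,4)] vector_derivative_affine[OF assms(2,3,4)]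
    by simp
qed

lemma elementwise_element:
  assumes "j \<in> {1..J}" "\<rho> \<in> element J j"
  shows "elementwise J c \<rho> = c j"
proof -
  have "\<lceil>real J * \<rho>\<rceil> = int j"
    using assms by (intro ceiling_unique) (auto simp: element_def node_def of_nat_diff field_simps)
  then show ?thesis by (simp add: elementwise_def)
qed

lemma K_space_affine:
  assumes "u \<in> K_space J" "j \<in> {1..J}"
  obtains a b where "\<And>\<rho>. \<rho> \<in> {node J (j - 1)..node J j} \<Longrightarrow> u \<rho> = a + b * \<rho>"
proof -
  have "\<forall>j\<in>{1..J}. \<exists>a b. \<forall>\<rho>\<in>{node J (j - 1)..node J j}. u \<rho> = a + b * \<rho>"
    using assms(1) unfolding K_space_def mem_Collect_eq by (rule conjunct2)
  from bspec[OF this assms(2)] obtain a b where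
    "\<forall>\<rho>\<in>{node J (j - 1)..node J j}. u \<rho> = a + b * \<rho>" by (elim exE)
  then show ?thesis by (intro that[of a b]) (erule bspec)
qed

lemma affine_K_space:
  assumes "u \<in> K_space J"
  shows "affine_on_elements J u"
  unfolding affine_on_elements_def
proof
  fix j assume j: "j \<in> {1..J}"
  obtain a b where "\<And>\<rho>. \<rho> \<in> {node J (j - 1)..node J j} \<Longrightarrow> u \<rho> = a + b * \<rho>"
    using K_space_affine[OF assms j] by metis
  then show "\<exists>a b. \<forall>\<rho>\<in>{node J (j - 1)..node J j}. u \<rho> = a + \<rho> *\<^sub>R b"
    by (intro exI[of _ a] exI[of _ b] ballI) simp
qed

lemma K_space_diff:
  assumes u: "u \<in> K_space J" and v: "v \<in> K_space J"
  shows "(\<lambda>\<rho>. u \<rho> - v \<rho>) \<in> K_space J"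
  unfolding K_space_def mem_Collect_eq
proof (intro conjI ballI)
  show "continuous_on {0..1} (\<lambda>\<rho>. u \<rho> - v \<rho>)"
    by (rule continuous_on_diff) (use u v in \<open>simp_all add: K_space_def\<close>)
  fix j assume j: "j \<in> {1..J}"
  obtain a b where 1: "\<And>\<rho>. \<rho> \<in> {node J (j - 1)..node J j} \<Longrightarrow> u \<rho> = a + b * \<rho>"
    using K_space_affine[OF u j] by metis
  obtain a' b' where 2: "\<And>\<rho>. \<rho> \<in> {node J (j - 1)..node J j} \<Longrightarrow> v \<rho> = a' + b' * \<rho>"
    using K_space_affine[OF v j] by metis
  show "\<exists>a b. \<forall>\<rho>\<in>{node J (j - 1)..node J j}. u \<rho> - v \<rho> = a + b * \<rho>"
    by (intro exI[of _ "a - a'"] exI[of _ "b - b'"] ballI) (simp add: 1 2 algebra_simps)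
qed

lemma X_space_diff: "X \<in> X_space J \<Longrightarrow> Y \<in> X_space J \<Longrightarrow> (\<lambda>\<rho>. X \<rho> - Y \<rho>) \<in> X_space J"
  by (auto simp: X_space_def K0_space_def intro: K_space_diff)

lemma affine_X_space:
  assumes "X \<in> X_space J"
  shows "affine_on_elements J X"
  unfolding affine_on_elements_def
proof
  fix j assume j: "j \<in> {1..J}"
  have K: "(\<lambda>\<rho>. X \<rho> $ 1) \<in> K_space J" "(\<lambda>\<rho>. X \<rho> $ 2) \<in> K_space J"
    using assms by (auto simp: X_space_def K0_space_def)
  obtain a b where 1: "\<And>\<rho>. \<rho> \<in> {node J (j - 1)..node J j} \<Longrightarrow> X \<rho> $ 1 = a + b * \<rho>"
    using K_space_affine[OF K(1) j] by metis
  obtain a' b' where 2: "\<And>\<rho>. \<rho> \<in> {node J (j - 1)..node J j} \<Longrightarrow> X \<rho> $ 2 = a' + b' * \<rho>"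
    using K_space_affine[OF K(2) j] by metis
  show "\<exists>a b. \<forall>\<rho>\<in>{node J (j - 1)..node J j}. X \<rho> = a + \<rho> *\<^sub>R b"
    by (intro exI[of _ "vector [a, a']"] exI[of _ "vector [b, b']"] ballI)
      (simp add: vec_eq_iff forall_2 1 2)
qed

lemma affine_scale:
  assumes "affine_on_elements J u"
  shows "affine_on_elements J (\<lambda>\<rho>. u \<rho> /\<^sub>R t)"
  unfolding affine_on_elements_def
proof
  fix j assume "j \<in> {1..J}"
  then obtain a b where "\<forall>\<rho>\<in>{node J (j - 1)..node J j}. u \<rho> = a + \<rho> *\<^sub>R b"
    using assms unfolding affine_on_elements_def by blast
  then show "\<exists>a b. \<forall>\<rho>\<in>{node J (j - 1)..node J j}. u \<rho> /\<^sub>R t = a + \<rho> *\<^sub>R b"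
    by (intro exI[of _ "a /\<^sub>R t"] exI[of _ "b /\<^sub>R t"]) (simp add: scaleR_add_right)
qed

text \<open>Multiplied by the old length, the inequality is \<open>(norm h' - norm h)^2 \<ge> 0\<close> combined with Cauchy-Schwarz.\<close>

lemma stretching_bound:
  fixes h h' :: "'a::real_inner"
  assumes "h \<noteq> 0"
  shows "norm h' - norm h \<le> h' \<bullet> (h' - h) / norm h"
proof -
  have "h' \<bullet> h \<le> norm h' * norm h" by (rule norm_cauchy_schwarz)
  moreover have "norm h' * norm h * 2 \<le> norm h'^2 + norm h^2"
    using sum_squares_bound[of "norm h'" "norm h"] by simp
  ultimately have "(norm h' - norm h) * norm h \<le> h' \<bullet> (h' - h)"
    by (simp add: inner_diff_right power2_norm_eq_inner[symmetric] algebra_simps power2_eq_square)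
  then show ?thesis using assms by (simp add: pos_le_divide_eq)
qed

text \<open>Here \<open>a\<close>, \<open>b\<close> are the old and \<open>c\<close>, \<open>d\<close> the new curvatures at the two ends of the edge. The increment splits
into a change of curvature at the old length, where \<open>c^2 - a^2 \<le> 2 * (c - a) * c\<close>, and a change of length
at the new curvature.\<close>

lemma bending_bound:
  fixes h h' :: "'a::real_inner"
  assumes "h \<noteq> 0"
  shows "norm h' * (c^2 + d^2) / 4 - norm h * (a^2 + b^2) / 4
    \<le> norm h / 2 * ((d - b) * d + (c - a) * c) + (c^2 + d^2) * (h' \<bullet> (h' - h) / norm h) / 4"
proof -
  have "norm h * (c^2 - a^2 + (d^2 - b^2)) \<le> norm h * (2 * ((d - b) * d + (c - a) * c))"
    using sum_squares_bound[of c a] sum_squares_bound[of d b]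
    by (intro mult_left_mono) (auto simp: algebra_simps power2_eq_square)
  moreover define D where "D = h' \<bullet> (h' - h) / norm h"
  moreover have "(c^2 + d^2) * (norm h' - norm h) \<le> (c^2 + d^2) * (h' \<bullet> (h' - h) / norm h)"
    by (intro mult_left_mono stretching_bound assms) auto
  ultimately show ?thesis unfolding D_def[symmetric] by (simp add: field_simps)
qed

section \<open>Energy decay in one time step\<close>

text \<open>Each step of the scheme is tested with the functions that make the chemical potential and the
derivative of the curvature cancel. The contributions of the \<open>j\<close>-th edge are \<open>p j\<close> (chemical potential
against normal motion), \<open>b j\<close> (anisotropic stress), \<open>a j\<close> (curvature derivative), \<open>c j\<close> (stretching
weighted by curvature) and \<open>k j\<close> (change of curvature).\<close>

lemma energy_step:
  assumes \<gamma>: "surface_energy_density \<gamma>" and q: "q \<in> {0, 1}" and S: "\<And>\<psi>. \<psi> \<in> {-pi..pi} \<Longrightarrow> S \<psi> \<in> stabilizing_values q \<gamma> \<psi>"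
    and pos: "0 < \<eta>" "0 < \<Delta>t"
    and X: "X \<in> X_space J" "X' \<in> X_space J" and \<mu>': "\<mu>' \<in> K_space J"
    and \<kappa>: "\<kappa> \<in> K0_space J" "\<kappa>' \<in> K0_space J"
    and edge: "\<And>j. j \<in> {1..J} \<Longrightarrow> edge J X j \<noteq> 0" "\<And>j. j \<in> {1..J} \<Longrightarrow> edge J X' j \<noteq> 0"
    and \<theta>: "tangent_angles J X \<theta>" "tangent_angles J X' \<theta>'"
    and step: "ES_PFEM_step q \<gamma> S \<epsilon> \<eta> \<sigma> \<Delta>t J \<theta> X \<kappa> X' \<mu>' \<kappa>'"
  shows "discrete_energy \<gamma> \<epsilon> \<sigma> J \<theta>' X' \<kappa>' \<le> discrete_energy \<gamma> \<epsilon> \<sigma> J \<theta> X \<kappa>"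
proof -
  define h h' N n where "h = edge J X" and "h' = edge J X'" and "N = (\<lambda>j. norm (h j))"
    and "n = (\<lambda>j. - (perp (h j) /\<^sub>R N j))"
  define \<delta> where "\<delta> = (\<lambda>j. h' j - h j)"
  define l r where "l = (\<lambda>j. node J (j - 1))" and "r = node J"
  define V where "V = (\<lambda>\<rho>. (X' \<rho> - X \<rho>) /\<^sub>R \<Delta>t)"
  define \<omega> where "\<omega> = (\<lambda>\<rho>. X' \<rho> - X \<rho>)"
  define b where "b = (\<lambda>j. (B_mat q \<gamma> (S (\<theta> j)) (\<theta> j) *v h' j) \<bullet> \<delta> j / N j)"
  define p where "p = (\<lambda>j. N j / 2 * (\<mu>' (r j) * (n j \<bullet> \<omega> (r j)) + \<mu>' (l j) * (n j \<bullet> \<omega> (l j))))"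
  define a where "a = (\<lambda>j. increment J \<kappa>' j * (n j \<bullet> \<delta> j) / N j)"
  define c where "c = (\<lambda>j. ((\<kappa>' (l j))^2 + (\<kappa>' (r j))^2) * (h' j \<bullet> \<delta> j / N j))"
  define k where "k = (\<lambda>j. N j / 2 * ((\<kappa>' (r j) - \<kappa> (r j)) * \<kappa>' (r j) + (\<kappa>' (l j) - \<kappa> (l j)) * \<kappa>' (l j)))"
  have N: "N j > 0" if "j \<in> {1..J}" for j using edge(1)[OF that] by (simp add: N_def h_def)
  have \<omega>X: "\<omega> \<in> X_space J" unfolding \<omega>_def by (intro X_space_diff X)
  have \<kappa>K: "\<kappa> \<in> K_space J" "\<kappa>' \<in> K_space J" using \<kappa> by (auto simp: K0_space_def)
  have V\<omega>: "V = (\<lambda>\<rho>. \<omega> \<rho> /\<^sub>R \<Delta>t)" by (simp add: V_def \<omega>_def)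
  note aff = affine_K_space[OF \<mu>'] affine_K_space[OF \<kappa>K(1)] affine_K_space[OF \<kappa>K(2)]
    affine_X_space[OF X(1)] affine_X_space[OF X(2)] affine_X_space[OF \<omega>X]
    affine_scale[OF affine_X_space[OF \<omega>X], of \<Delta>t, folded V\<omega>]
  have tr: "has_traces J \<mu>' (\<lambda>j. \<mu>' (l j)) (\<lambda>j. \<mu>' (r j))"
    "has_traces J \<kappa> (\<lambda>j. \<kappa> (l j)) (\<lambda>j. \<kappa> (r j))"
    "has_traces J \<kappa>' (\<lambda>j. \<kappa>' (l j)) (\<lambda>j. \<kappa>' (r j))"
    "has_traces J \<omega> (\<lambda>j. \<omega> (l j)) (\<lambda>j. \<omega> (r j))"
    "has_traces J V (\<lambda>j. V (l j)) (\<lambda>j. V (r j))"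
    unfolding l_def r_def by (intro has_traces_affine aff)+
  have trn: "has_traces J (normal J X) n n"
    by (rule has_traces_const) (simp add: normal_def elementwise_element n_def N_def h_def)
  have inc: "increment J X' j = h' j" "increment J \<omega> j = \<delta> j" "increment J V j = \<delta> j /\<^sub>R \<Delta>t" for j
    by (simp_all add: increment_def h_def h'_def \<delta>_def edge_def \<omega>_def V_def scaleR_diff_right)
  have trd: "has_traces J (arc_deriv X u) (\<lambda>j. increment J u j /\<^sub>R N j) (\<lambda>j. increment J u j /\<^sub>R N j)"
    if "affine_on_elements J u" for u :: "real \<Rightarrow> 'z::real_normed_vector"
    by (rule has_traces_const) (simp add: arc_deriv_affine aff that N_def h_def)
  have trB: "has_traces J
      (\<lambda>\<rho>. (let \<psi> = elementwise J \<theta> \<rho> in B_mat q \<gamma> (S \<psi>) \<psi>) *v arc_deriv X X' \<rho>)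
      (\<lambda>j. B_mat q \<gamma> (S (\<theta> j)) (\<theta> j) *v (h' j /\<^sub>R N j))
      (\<lambda>j. B_mat q \<gamma> (S (\<theta> j)) (\<theta> j) *v (h' j /\<^sub>R N j))"
    by (rule has_traces_const)
      (simp add: arc_deriv_affine[OF aff(4,5)] elementwise_element Let_def inc[unfolded N_def h_def] N_def h_def)
  have \<Delta>0: "\<Delta>t \<noteq> 0" using pos by simp
  have N_edge: "norm (edge J X j) = N j" for j by (simp add: N_def h_def)
  have lt: "lumped J X u v = (\<Sum>j=1..J. f j)"
    if "has_traces J u u\<^sub>l u\<^sub>r" "has_traces J v v\<^sub>l v\<^sub>r"
      and "\<And>j. N j > 0 \<Longrightarrow> N j / 2 * (u\<^sub>r j \<bullet> v\<^sub>r j + u\<^sub>l j \<bullet> v\<^sub>l j) = f j"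
    for u v :: "real \<Rightarrow> 'z::real_inner" and u\<^sub>l u\<^sub>r v\<^sub>l v\<^sub>r f
    unfolding lumped_traces[OF that(1,2)] N_edge by (rule sum.cong[OF refl], rule that(3), rule N)
  note step' = step[unfolded ES_PFEM_step_def Let_def]
  \<comment> \<open>The first equation, tested with \<open>\<mu>'\<close>: the pairing of \<open>\<mu>'\<close> with the normal motion is dissipative.\<close>
  have L1: "lumped J X (\<lambda>\<rho>. V \<rho> \<bullet> normal J X \<rho>) \<mu>' = (\<Sum>j=1..J. p j / \<Delta>t)"
    by (rule lt[OF has_traces_inner[OF tr(5) trn] tr(1)])
      (simp add: p_def V\<omega> inner_commute \<Delta>0 field_simps)
  have L2: "lumped J X (arc_deriv X \<mu>') (arc_deriv X \<mu>') \<ge> 0"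
    unfolding lumped_traces[OF trd[OF aff(1)] trd[OF aff(1)]]
    by (intro sum_nonneg mult_nonneg_nonneg add_nonneg_nonneg inner_ge_zero) simp
  have E1: "(\<Sum>j=1..J. p j / \<Delta>t) + lumped J X (arc_deriv X \<mu>') (arc_deriv X \<mu>') = 0"
    using bspec[OF conjunct1[OF step'] \<mu>'] unfolding L1[unfolded V_def] .
  \<comment> \<open>The second equation, tested with the displacement.\<close>
  have L3: "lumped J X \<mu>' (\<lambda>\<rho>. normal J X \<rho> \<bullet> \<omega> \<rho>) = (\<Sum>j=1..J. p j)"
    by (rule lt[OF tr(1) has_traces_inner[OF trn tr(4)]]) (simp add: p_def)
  have L4: "lumped J X (\<lambda>\<rho>. (let \<psi> = elementwise J \<theta> \<rho> in B_mat q \<gamma> (S \<psi>) \<psi>) *v arc_deriv X X' \<rho>)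
      (arc_deriv X \<omega>) = (\<Sum>j=1..J. b j)"
    by (rule lt[OF trB trd[OF aff(6)]])
      (simp add: b_def inc matrix_vector_mult_scaleR field_simps)
  have L5: "lumped J X
      (\<lambda>\<rho>. arc_deriv X \<kappa>' \<rho> *\<^sub>R normal J X \<rho> - (1/2 * (\<kappa>' \<rho>)^2) *\<^sub>R arc_deriv X X' \<rho>)
      (arc_deriv X \<omega>) = (\<Sum>j=1..J. a j - c j / 4)"
    by (rule lt[OF has_traces_diff[OF has_traces_scaleR[OF trd[OF aff(3)] trn]
            has_traces_scaleR[OF has_traces_cmult[OF has_traces_power2[OF tr(3)]] trd[OF aff(5)]]]
          trd[OF aff(6)]])
      (simp add: a_def c_def inc inner_diff_left field_simps)
  have E2: "(\<Sum>j=1..J. p j) - (\<Sum>j=1..J. b j) - \<epsilon>^2 * (\<Sum>j=1..J. a j - c j / 4)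
      - 1 / \<eta> * ((X' 0 $ 1 - X 0 $ 1) / \<Delta>t * \<omega> 0 $ 1 + (X' 1 $ 1 - X 1 $ 1) / \<Delta>t * \<omega> 1 $ 1)
      + \<sigma> * (\<omega> 1 $ 1 - \<omega> 0 $ 1) = 0"
    using bspec[OF conjunct1[OF conjunct2[OF step']] \<omega>X]
    unfolding L3 L4[unfolded Let_def] L5 .
  \<comment> \<open>The third equation, tested with the new curvature.\<close>
  have L6: "lumped J X (\<lambda>\<rho>. (\<kappa>' \<rho> - \<kappa> \<rho>) / \<Delta>t) \<kappa>' = (\<Sum>j=1..J. k j / \<Delta>t)"
    by (rule lt[OF has_traces_divide[OF has_traces_diff[OF tr(3) tr(2)]] tr(3)])
      (simp add: k_def \<Delta>0 field_simps)
  have L7: "lumped J X (\<lambda>\<rho>. normal J X \<rho> \<bullet> arc_deriv X V \<rho>) (arc_deriv X \<kappa>') = (\<Sum>j=1..J. a j / \<Delta>t)"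
    by (rule lt[OF has_traces_inner[OF trn trd[OF aff(7)]] trd[OF aff(3)]])
      (simp add: a_def inc \<Delta>0 field_simps)
  have L8: "lumped J X (\<lambda>\<rho>. (arc_deriv X X' \<rho> \<bullet> arc_deriv X V \<rho>) * \<kappa>' \<rho>) \<kappa>' = (\<Sum>j=1..J. c j / 2 / \<Delta>t)"
    by (rule lt[OF has_traces_mult[OF has_traces_inner[OF trd[OF aff(5)] trd[OF aff(7)]] tr(3)] tr(3)])
      (simp add: c_def inc \<Delta>0 field_simps power2_eq_square)
  have E3: "(\<Sum>j=1..J. k j / \<Delta>t) - (\<Sum>j=1..J. a j / \<Delta>t) + (\<Sum>j=1..J. c j / 2 / \<Delta>t) = 0"
    using bspec[OF conjunct2[OF conjunct2[OF step']] \<kappa>(2)] unfolding L6 L7[unfolded V_def] L8[unfolded V_def] .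
  have "(\<Sum>j=1..J. p j) / \<Delta>t \<le> 0" using E1 L2 unfolding sum_divide_distrib by linarith
  then have E1': "(\<Sum>j=1..J. p j) \<le> 0" using pos by (simp add: divide_le_0_iff)
  have D: "1 / \<eta> * ((X' 0 $ 1 - X 0 $ 1) / \<Delta>t * \<omega> 0 $ 1 + (X' 1 $ 1 - X 1 $ 1) / \<Delta>t * \<omega> 1 $ 1) \<ge> 0"
    using pos by (simp add: \<omega>_def)
  have E3': "(\<Sum>j=1..J. a j) = (\<Sum>j=1..J. k j) + (\<Sum>j=1..J. c j) / 2"
    using E3 pos by (simp add: sum_divide_distrib[symmetric] field_simps)
  \<comment> \<open>The curvature equation eliminates \<open>a\<close>, which the two equations share.\<close>
  have "\<epsilon>^2 * (\<Sum>j=1..J. a j - c j / 4) = \<epsilon>^2 * (\<Sum>j=1..J. k j + c j / 4)"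
    using E3' by (simp add: sum_subtractf sum.distrib sum_divide_distrib[symmetric])
  with E2 E1' D have balance: "(\<Sum>j=1..J. b j) + \<epsilon>^2 * (\<Sum>j=1..J. k j + c j / 4)
      \<le> \<sigma> * (\<omega> 1 $ 1 - \<omega> 0 $ 1)" by linarith
  have "(\<Sum>j=1..J. norm (h' j) * \<gamma> (\<theta>' j) - norm (h j) * \<gamma> (\<theta> j)) \<le> (\<Sum>j=1..J. b j)"
  proof (rule sum_mono)
    fix j assume j: "j \<in> {1..J}"
    with \<theta> have t: "\<theta> j \<in> {-pi..pi}" "\<theta>' j \<in> {-pi..pi}"
      "h j /\<^sub>R norm (h j) = unit_vec (\<theta> j)" "h' j /\<^sub>R norm (h' j) = unit_vec (\<theta>' j)"
      unfolding tangent_angles_def h_def h'_def by blast+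
    show "norm (h' j) * \<gamma> (\<theta>' j) - norm (h j) * \<gamma> (\<theta> j) \<le> b j"
      unfolding b_def N_def \<delta>_def
      by (rule edge_energy[OF \<gamma> q S[OF t(1)] t(2) _ _ t(3,4)])
        (use edge j in \<open>auto simp: h_def h'_def\<close>)
  qed
  moreover have "\<epsilon>^2 * (\<Sum>j=1..J. norm (h' j) * ((\<kappa>' (l j))^2 + (\<kappa>' (r j))^2) / 4
      - norm (h j) * ((\<kappa> (l j))^2 + (\<kappa> (r j))^2) / 4) \<le> \<epsilon>^2 * (\<Sum>j=1..J. k j + c j / 4)"
    unfolding k_def c_def N_def \<delta>_def using edge(1)
    by (intro mult_left_mono sum_mono bending_bound) (auto simp: h_def)
  ultimately show ?thesis using balance
    unfolding discrete_energy_def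
    by (simp add: h_def h'_def l_def r_def \<omega>_def sum_subtractf sum_divide_distrib[symmetric] algebra_simps)
qed

theorem theorem4p1:
  fixes q :: nat and \<gamma> :: "real \<Rightarrow> real"
  assumes "q \<in> {0, 1}"
    and "surface_energy_density \<gamma>"
    and "q = 0 \<Longrightarrow> \<forall>\<theta>. \<gamma> \<theta> = \<gamma> (pi + \<theta>)"
    and "q = 1 \<Longrightarrow> \<forall>\<theta>. 3 * \<gamma> \<theta> > \<gamma> (pi + \<theta>)"
  shows "\<exists>S\<^sub>0 :: real \<Rightarrow> real.
    (\<forall>\<theta>\<in>{-pi..pi}. minimal_stab q \<gamma> \<theta> = ereal (S\<^sub>0 \<theta>)) \<and>
    (\<forall>(S :: real \<Rightarrow> real) (\<epsilon> :: real) (\<eta> :: real) (\<sigma> :: real) (\<Delta>t :: real) (J :: nat) (M :: nat)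
       (X :: nat \<Rightarrow> real \<Rightarrow> real^2) (\<mu> :: nat \<Rightarrow> real \<Rightarrow> real) (\<kappa> :: nat \<Rightarrow> real \<Rightarrow> real)
       (\<theta> :: nat \<Rightarrow> nat \<Rightarrow> real).
       0 < \<epsilon> \<longrightarrow> \<epsilon> \<le> 1 \<longrightarrow> 0 < \<eta> \<longrightarrow> 0 < \<Delta>t \<longrightarrow> 1 \<le> J \<longrightarrow>
       ES_PFEM_solution q \<gamma> S \<epsilon> \<eta> \<sigma> \<Delta>t J M X \<mu> \<kappa> \<theta> \<longrightarrow>
       (\<forall>\<psi>\<in>{-pi..pi}. S \<psi> \<ge> S\<^sub>0 \<psi>) \<longrightarrow>
       (let W = (\<lambda>m. discrete_energy \<gamma> \<epsilon> \<sigma> J (\<theta> m) (X m) (\<kappa> m))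
        in \<forall>m<M. \<forall>k\<le>m. W (Suc k) \<le> W k))"
proof (intro exI[of _ "\<lambda>\<theta>. Inf (stabilizing_values q \<gamma> \<theta>)"] conjI ballI allI impI)
  fix \<theta> :: real assume "\<theta> \<in> {-pi..pi}"
  then show "minimal_stab q \<gamma> \<theta> = ereal (Inf (stabilizing_values q \<gamma> \<theta>))"
    using assms by (intro minimal_stab_eq_Inf(1)) auto
next
  fix S :: "real \<Rightarrow> real" and \<epsilon> \<eta> \<sigma> \<Delta>t :: real and J M :: nat
    and X :: "nat \<Rightarrow> real \<Rightarrow> real^2" and \<mu> \<kappa> :: "nat \<Rightarrow> real \<Rightarrow> real" and \<theta> :: "nat \<Rightarrow> nat \<Rightarrow> real"
  assume pos: "0 < \<eta>" "0 < \<Delta>t"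
    and sol: "ES_PFEM_solution q \<gamma> S \<epsilon> \<eta> \<sigma> \<Delta>t J M X \<mu> \<kappa> \<theta>"
    and S: "\<forall>\<psi>\<in>{-pi..pi}. Inf (stabilizing_values q \<gamma> \<psi>) \<le> S \<psi>"
  have stab: "S \<psi> \<in> stabilizing_values q \<gamma> \<psi>" if "\<psi> \<in> {-pi..pi}" for \<psi>
    using S that assms by (intro minimal_stab_eq_Inf(2)) auto
  have "discrete_energy \<gamma> \<epsilon> \<sigma> J (\<theta> (Suc k)) (X (Suc k)) (\<kappa> (Suc k))
      \<le> discrete_energy \<gamma> \<epsilon> \<sigma> J (\<theta> k) (X k) (\<kappa> k)" if "k < M" for k
  proof (rule energy_step[OF assms(2,1) stab pos])
    have k: "k \<le> M" "Suc k \<le> M" using that by auto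
    show "X k \<in> X_space J" "X (Suc k) \<in> X_space J" "\<mu> (Suc k) \<in> K_space J"
      "\<kappa> k \<in> K0_space J" "\<kappa> (Suc k) \<in> K0_space J"
      "tangent_angles J (X k) (\<theta> k)" "tangent_angles J (X (Suc k)) (\<theta> (Suc k))"
      using sol k unfolding ES_PFEM_solution_def by blast+
    show "edge J (X k) j \<noteq> 0" "edge J (X (Suc k)) j \<noteq> 0" if "j \<in> {1..J}" for j
      using sol k that unfolding ES_PFEM_solution_def by blast+
    show "ES_PFEM_step q \<gamma> S \<epsilon> \<eta> \<sigma> \<Delta>t J (\<theta> k) (X k) (\<kappa> k) (X (Suc k)) (\<mu> (Suc k)) (\<kappa> (Suc k))"
      using sol that unfolding ES_PFEM_solution_def by blast
  qed
  then show "let W = (\<lambda>m. discrete_energy \<gamma> \<epsilon> \<sigma> J (\<theta> m) (X m) (\<kappa> m))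
      in \<forall>m<M. \<forall>k\<le>m. W (Suc k) \<le> W k"
    unfolding Let_def by simp
qed

end
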